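(* Let $\mathcal{M}=\{M^x:x\in\Lambda\}$ with $\Lambda=\mathbb{R}_{>0}$ be a standard log-convex weight matrix such that for every $x\in\Lambda$ there exists $y\in\Lambda$ with $(m^y)^\circ\preceq m^x$. Let $E,F$ be Banach spaces, $U\subseteq E$ open and $f:U\to F$ a smooth mapping. Then the following are equivalent: (1) $f$ is of class $\mathcal{E}_{(\mathcal{M})}=\mathcal{E}^{\mathrm{b}}_{(\mathcal{M})}$. (2) For each compact $K\subseteq U$, each $(r_k)_k\in\mathcal{R}_{\mathrm{Beur}}$ and each $(s_k)_k\in\mathcal{S}^{\mathcal{M}}_{\mathrm{Beur}}$ the set $$\left\{\frac{f^{(k)}(a)(v_1,\dots,v_k)}{k!}r_ks_k:\ a\in K,\ k\in\mathbb{N},\ \|v_i\|_E\le 1\right\}$$ is bounded in $F$. (3) For each compact $K\subseteq U$, each $(r_k)_k\in\mathcal{R}_{\mathrm{Beur},\mathrm{sub}}$ and each $(s_k)_k\in\mathcal{S}^{\mathcal{M}}_{\mathrm{Beur},\mathrm{FdB}}$ the set $$\left\{\frac{f^{(k)}(a)(v_1,\dots,v_k)}{k!}r_ks_k\delta^k:\ a\in K,\ k\in\mathbb{N},\ \|v_i\|_E\le 1\right\}$$ is bounded in $F$ for each $\delta>0$.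
   Context: Weight matrices. $\mathbb{N}=\{0,1,2,\dots\}$. A weight sequence $M=(M_k)_{k\in\mathbb{N}}$ is a sequence of positive reals; it is normalized if $1=M_0\le M_1$ and log-convex if $M_j^2\le M_{j-1}M_{j+1}$ for all $j\ge 1$. A standard log-convex weight matrix with index set $\Lambda=\mathbb{R}_{>0}$ (natural order) is a family $\mathcal{M}=\{M^x:x\in\Lambda\}$ of normalized, log-convex weight sequences with $\lim_{k\to\infty}(M^x_k)^{1/k}=+\infty$ for each $x$ and $M^x_k\le M^y_k$ for all $k$ whenever $x\le y$. Put $m^x_k:=M^x_k/k!$. For a positive sequence $m$, $m^\circ_0:=1$ and $m^\circ_k:=\max\{m_jm_{\alpha_1}\cdots m_{\alpha_j}:\alpha_i\in\mathbb{N}_{>0},\ \alpha_1+\dots+\alpha_j=k\}$ for $k\geq 1$. $M\preceq N$ means: there are $C_1,C_2\ge1$ with $M_j\le C_2C_1^jN_j$ for all $j$. Sequence families (all sequences are sequences of positive reals normalized by $r_0=1$, $s_0=1$): $\mathcal{R}_{\mathrm{Beur}}$: all $(r_k)_k$ with $r_kt^k\to0$ as $k\to\infty$ for some $t>0$. $\mathcal{R}_{\mathrm{Beur},\mathrm{sub}}$: all $(r_k)_k\in\mathcal{R}_{\mathrm{Beur}}$ with $r_{j+k}\le r_jr_k$ for all $j,k\in\mathbb{N}$. $\mathcal{S}^{\mathcal{M}}_{\mathrm{Beur}}$: all $(s_k)_k$ for which there are $x\in\Lambda$ and $C_x>0$ with $s_km^x_k\le C_x^k$ for all $k$. $\mathcal{S}^{\mathcal{M}}_{\mathrm{Beur},\mathrm{FdB}}$: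 all $(s_k)_k\in\mathcal{S}^{\mathcal{M}}_{\mathrm{Beur}}$ for which there are $(\hat s_k)_k\in\mathcal{S}^{\mathcal{M}}_{\mathrm{Beur}}$ and $D>0$ with $s_k\le D^k(\hat s_o)_k$ for all $k$, where $(s_o)_0:=1$ and $(s_o)_k:=\min\{s_js_{\alpha_1}\cdots s_{\alpha_j}:\alpha_i\in\mathbb{N}_{>0},\ \alpha_1+\dots+\alpha_j=k\}$. Classes. For a closed absolutely convex bounded set $B\subseteq E$, $E_B$ is the linear span of $B$ normed by its Minkowski functional $\|\cdot\|_B$, $i_B:E_B\to E$ the inclusion, $U_B=i_B^{-1}(U)$. For $W$ open in a Banach space, $\mathcal{E}_{(\mathcal{M})}(W,\mathbb{R})$ is the set of smooth $g:W\to\mathbb{R}$ such that for every compact $K\subseteq W$, all $x\in\Lambda$ and all $h>0$, $\sup_{k\in\mathbb{N},a\in K}\|g^{(k)}(a)\|/(h^kM^x_k)<\infty$. A smooth $f:U\to F$ is $\mathcal{E}_{(\mathcal{M})}$ if $\alpha\circ f\circ i_B\in\mathcal{E}_{(\mathcal{M})}(U_B,\mathbb{R})$ for all continuous linear functionals $\alpha$ on $F$ and all such $B$. It is $\mathcal{E}^{\mathrm{b}}_{(\mathcal{M})}$ if for every such $B$, every $K\subseteq U\cap E_B$ compact in $\|\cdot\|_B$, all $x\in\Lambda$ and all $h>0$ the set $\{f^{(k)}(a)(v_1,\dots,v_k)/(h^kM^x_k):k\in\mathbb{N},a\in K,\|v_i\|_B\le1\}$ is bounded in $F$ (for Banach $E$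 it suffices to take $B$ the closed unit ball). *)

theory Defs
  imports "HOL-Analysis.Analysis"
begin

section \<open>Weight matrices\<close>

definition weight_sequence :: "(nat \<Rightarrow> real) \<Rightarrow> bool" where
  "weight_sequence M \<longleftrightarrow> (\<forall>k. 0 < M k)"

definition normalized_weight :: "(nat \<Rightarrow> real) \<Rightarrow> bool" where
  "normalized_weight M \<longleftrightarrow> M 0 = 1 \<and> 1 \<le> M 1"

definition log_convex :: "(nat \<Rightarrow> real) \<Rightarrow> bool" where
  "log_convex M \<longleftrightarrow> (\<forall>j\<ge>1. (M j)\<^sup>2 \<le> M (j - 1) * M (j + 1))"

text \<open>The index set is the set of positive reals; the values of \<open>M x\<close> for \<open>x \<le> 0\<close> are
  irrelevant.\<close>

definition standard_log_convex_matrix :: "(real \<Rightarrow> nat \<Rightarrow> real) \<Rightarrow> bool" where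
  "standard_log_convex_matrix M \<longleftrightarrow>
     (\<forall>x>0. weight_sequence (M x) \<and> normalized_weight (M x) \<and> log_convex (M x) \<and>
            filterlim (\<lambda>k. root k (M x k)) at_top sequentially) \<and>
     (\<forall>x>0. \<forall>y\<ge>x. \<forall>k. M x k \<le> M y k)"

definition div_fact :: "(nat \<Rightarrow> real) \<Rightarrow> nat \<Rightarrow> real" where
  "div_fact M k = M k / fact k"

definition compositions :: "nat \<Rightarrow> nat list set" where
  "compositions k = {\<alpha>. (\<forall>i\<in>set \<alpha>. 0 < i) \<and> sum_list \<alpha> = k}"

text \<open>In the next two definitions \<open>\<alpha> = [\<alpha>\<^sub>1, \<dots>, \<alpha>\<^sub>j]\<close>, so that \<open>j = length \<alpha>\<close>;
  the sets are finite and nonempty (see below).\<close>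

definition upper_circ :: "(nat \<Rightarrow> real) \<Rightarrow> nat \<Rightarrow> real" where
  "upper_circ m k =
     (if k = 0 then 1 else Max {m (length \<alpha>) * prod_list (map m \<alpha>) |\<alpha>. \<alpha> \<in> compositions k})"

definition lower_circ :: "(nat \<Rightarrow> real) \<Rightarrow> nat \<Rightarrow> real" where
  "lower_circ s k =
     (if k = 0 then 1 else Min {s (length \<alpha>) * prod_list (map s \<alpha>) |\<alpha>. \<alpha> \<in> compositions k})"

definition seq_preceq :: "(nat \<Rightarrow> real) \<Rightarrow> (nat \<Rightarrow> real) \<Rightarrow> bool" where
  "seq_preceq M N \<longleftrightarrow> (\<exists>C1\<ge>1. \<exists>C2\<ge>1. \<forall>j. M j \<le> C2 * C1 ^ j * N j)"

lemma finite_compositions: "finite (compositions k)"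
proof (rule finite_subset)
  show "compositions k \<subseteq> {xs. set xs \<subseteq> {..k} \<and> length xs \<le> k}"
  proof
    fix \<alpha> assume "\<alpha> \<in> compositions k"
    then have pos: "\<forall>i\<in>set \<alpha>. 0 < i" and s: "sum_list \<alpha> = k"
      by (auto simp: compositions_def)
    have "length \<alpha> \<le> sum_list \<alpha>" using pos by (induction \<alpha>) auto
    then show "\<alpha> \<in> {xs. set xs \<subseteq> {..k} \<and> length xs \<le> k}"
      using s by (auto intro: member_le_sum_list)
  qed
qed (simp add: finite_lists_length_le)

lemma compositions_nonempty: "0 < k \<Longrightarrow> [k] \<in> compositions k"
  by (simp add: compositions_def)


section \<open>Test sequences\<close>

definition normalized_pos :: "(nat \<Rightarrow> real) \<Rightarrow> bool" where
  "normalized_pos r \<longleftrightarrow> (\<forall>k. 0 < r k) \<and> r 0 = 1"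

definition R_Beur :: "(nat \<Rightarrow> real) set" where
  "R_Beur = {r. normalized_pos r \<and> (\<exists>t>0. (\<lambda>k. r k * t ^ k) \<longlonglongrightarrow> 0)}"

definition R_Beur_sub :: "(nat \<Rightarrow> real) set" where
  "R_Beur_sub = {r \<in> R_Beur. \<forall>j k. r (j + k) \<le> r j * r k}"

definition S_Beur :: "(real \<Rightarrow> nat \<Rightarrow> real) \<Rightarrow> (nat \<Rightarrow> real) set" where
  "S_Beur M =
     {s. normalized_pos s \<and> (\<exists>x>0. \<exists>C>0. \<forall>k. s k * div_fact (M x) k \<le> C ^ k)}"

definition S_Beur_FdB :: "(real \<Rightarrow> nat \<Rightarrow> real) \<Rightarrow> (nat \<Rightarrow> real) set" where
  "S_Beur_FdB M =
     {s \<in> S_Beur M. \<exists>s'\<in>S_Beur M. \<exists>D>0. \<forall>k. s k \<le> D ^ k * lower_circ s' k}"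


section \<open>Smooth maps between normed spaces\<close>

text \<open>The spaces \<open>E\<^sub>B\<close> carry a norm of their own, so the Frechet calculus is set up for a
  linear subspace \<open>V\<close> with an explicit norm \<open>N\<close>. The space \<open>E\<close> itself is the case
  \<open>V = UNIV\<close>, \<open>N = norm\<close>.\<close>

definition bounded_multilinear_on ::
    "'a::real_vector set \<Rightarrow> ('a \<Rightarrow> real) \<Rightarrow> nat \<Rightarrow> ('a list \<Rightarrow> 'b::real_normed_vector) \<Rightarrow> bool" where
  "bounded_multilinear_on V N k T \<longleftrightarrow>
     (\<forall>us\<in>lists V. \<forall>ws\<in>lists V. length us + length ws + 1 = k \<longrightarrow>
        (\<forall>x\<in>V. \<forall>y\<in>V. \<forall>b c. T (us @ (b *\<^sub>R x + c *\<^sub>R y) # ws) =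
                                 b *\<^sub>R T (us @ x # ws) + c *\<^sub>R T (us @ y # ws))) \<and>
     (\<exists>C. \<forall>vs\<in>lists V. length vs = k \<longrightarrow> norm (T vs) \<le> C * prod_list (map N vs))"

text \<open>\<open>D a [v\<^sub>1, \<dots>, v\<^sub>k]\<close> stands for \<open>g\<^sup>(\<^sup>k\<^sup>)(a)(v\<^sub>1, \<dots>, v\<^sub>k)\<close>. The last clause says that
  \<open>g\<^sup>(\<^sup>k\<^sup>)\<close>, as a map from \<open>W\<close> into the \<open>k\<close>-linear maps with the operator norm, is Frechet
  differentiable at \<open>a\<close> with derivative \<open>g\<^sup>(\<^sup>k\<^sup>+\<^sup>1\<^sup>)(a)\<close>.\<close>

definition derivative_tower ::
    "'a::real_vector set \<Rightarrow> ('a \<Rightarrow> real) \<Rightarrow> 'a set \<Rightarrow> ('a \<Rightarrow> 'b::real_normed_vector) \<Rightarrow>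
     ('a \<Rightarrow> 'a list \<Rightarrow> 'b) \<Rightarrow> bool" where
  "derivative_tower V N W g D \<longleftrightarrow>
     (\<forall>a\<in>W. D a [] = g a) \<and>
     (\<forall>a\<in>W. \<forall>k. bounded_multilinear_on V N k (D a)) \<and>
     (\<forall>a\<in>W. \<forall>k. \<forall>e>0. \<exists>d>0. \<forall>x\<in>W. N (x - a) < d \<longrightarrow>
        (\<forall>vs\<in>lists V. length vs = k \<longrightarrow>
           norm (D x vs - D a vs - D a ((x - a) # vs)) \<le> e * N (x - a) * prod_list (map N vs)))"

text \<open>To be used for sets \<open>W\<close> that are open in \<open>(V, N)\<close>.\<close>

definition smooth_map ::
    "'a::real_vector set \<Rightarrow> ('a \<Rightarrow> real) \<Rightarrow> 'a set \<Rightarrow> ('a \<Rightarrow> 'b::real_normed_vector) \<Rightarrow> bool" where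
  "smooth_map V N W g \<longleftrightarrow> (\<exists>D. derivative_tower V N W g D)"

definition higher_deriv ::
    "'a::real_vector set \<Rightarrow> ('a \<Rightarrow> real) \<Rightarrow> 'a set \<Rightarrow> ('a \<Rightarrow> 'b::real_normed_vector) \<Rightarrow>
     'a \<Rightarrow> 'a list \<Rightarrow> 'b" where
  "higher_deriv V N W g = (SOME D. derivative_tower V N W g D)"

text \<open>The choice in \<open>higher_deriv\<close> is immaterial, and for \<open>(UNIV, norm)\<close> the first derivative
  is the one of the library.\<close>

lemma derivative_tower_unique:
  fixes g :: "'a::real_vector \<Rightarrow> 'b::real_normed_vector"
  assumes V: "subspace V"
    and N_nonneg: "\<And>x. x \<in> V \<Longrightarrow> 0 \<le> N x"
    and N_scale: "\<And>c x. x \<in> V \<Longrightarrow> N (c *\<^sub>R x) = \<bar>c\<bar> * N x"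
    and W: "W \<subseteq> V" "\<And>a. a \<in> W \<Longrightarrow> \<exists>d>0. \<forall>x\<in>V. N (x - a) < d \<longrightarrow> x \<in> W"
    and D: "derivative_tower V N W g D" and D': "derivative_tower V N W g D'"
    and a: "a \<in> W" and vs: "vs \<in> lists V"
  shows "D a vs = D' a vs"
  using vs a
proof (induction vs arbitrary: a)
  case Nil
  then show ?case using D D' by (simp add: derivative_tower_def)
next
  case (Cons v vs)
  then have v: "v \<in> V" and vs: "vs \<in> lists V" and a: "a \<in> W" by auto
  define P where "P = prod_list (map N vs)"
  have P: "0 \<le> P"
    using vs unfolding P_def by (induction vs) (auto simp: N_nonneg)
  have lin: "T a ((t *\<^sub>R v) # vs) = t *\<^sub>R T a (v # vs)"
    if T: "derivative_tower V N W g T" for T t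
  proof -
    have "bounded_multilinear_on V N (Suc (length vs)) (T a)"
      using T a by (simp add: derivative_tower_def)
    then have "\<forall>x\<in>V. \<forall>y\<in>V. \<forall>b c. T a ([] @ (b *\<^sub>R x + c *\<^sub>R y) # vs) =
        b *\<^sub>R T a ([] @ x # vs) + c *\<^sub>R T a ([] @ y # vs)"
      unfolding bounded_multilinear_on_def using vs by (metis add_0 list.size(3) lists.Nil plus_1_eq_Suc add.commute)
    from bspec[OF bspec[OF this v] v, rule_format, of t 0] show ?thesis by simp
  qed
  have "norm (D a (v # vs) - D' a (v # vs)) \<le> e" if e: "0 < e" for e
  proof -
    define c where "c = e / (2 * (N v * P + 1))"
    have NP: "0 \<le> N v * P" using v P N_nonneg by simp
    then have c: "0 < c" using e by (simp add: c_def)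
    have rem: "\<exists>d>0. \<forall>x\<in>W. N (x - a) < d \<longrightarrow>
        norm (T x vs - T a vs - T a ((x - a) # vs)) \<le> c * N (x - a) * P"
      if "derivative_tower V N W g T" for T
    proof -
      have "\<forall>a\<in>W. \<forall>k. \<forall>e>0. \<exists>d>0. \<forall>x\<in>W. N (x - a) < d \<longrightarrow> (\<forall>vs\<in>lists V. length vs = k \<longrightarrow>
          norm (T x vs - T a vs - T a ((x - a) # vs)) \<le> e * N (x - a) * prod_list (map N vs))"
        using that unfolding derivative_tower_def by (elim conjE)
      from this[rule_format, OF a c, of "length vs"] show ?thesis
        using vs unfolding P_def by blast
    qed
    obtain d1 where d1: "0 < d1" "\<And>x. x \<in> W \<Longrightarrow> N (x - a) < d1 \<Longrightarrow>
        norm (D x vs - D a vs - D a ((x - a) # vs)) \<le> c * N (x - a) * P"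
      using rem[OF D] by blast
    obtain d2 where d2: "0 < d2" "\<And>x. x \<in> W \<Longrightarrow> N (x - a) < d2 \<Longrightarrow>
        norm (D' x vs - D' a vs - D' a ((x - a) # vs)) \<le> c * N (x - a) * P"
      using rem[OF D'] by blast
    obtain d3 where d3: "0 < d3" "\<And>x. x \<in> V \<Longrightarrow> N (x - a) < d3 \<Longrightarrow> x \<in> W"
      using W(2)[OF a] by blast
    define d where "d = min d1 (min d2 d3)"
    define t where "t = d / (2 * (N v + 1))"
    have Nv: "0 \<le> N v" using v N_nonneg by simp
    have d: "0 < d" using d1 d2 d3 by (simp add: d_def)
    then have t: "0 < t" using Nv by (simp add: t_def)
    have "t * N v = d * (N v / (2 * (N v + 1)))" by (simp add: t_def)
    also have "\<dots> < d * 1"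
      using d Nv by (intro mult_strict_left_mono) (auto simp: divide_simps)
    finally have tN: "t * N v < d" by simp
    define x where "x = a + t *\<^sub>R v"
    have xa: "x - a = t *\<^sub>R v" by (simp add: x_def)
    have Nx: "N (x - a) = t * N v" using N_scale[OF v] t by (simp add: xa)
    have xW: "x \<in> W"
      using d3(2)[of x] tN Nx a W(1) V v by (auto simp: x_def d_def subspace_add subspace_scale)
    have 1: "norm (D x vs - D a vs - t *\<^sub>R D a (v # vs)) \<le> c * (t * N v) * P"
      using d1(2)[OF xW] tN Nx lin[OF D] by (simp add: xa d_def)
    have 2: "norm (D' x vs - D' a vs - t *\<^sub>R D' a (v # vs)) \<le> c * (t * N v) * P"
      using d2(2)[OF xW] tN Nx lin[OF D'] by (simp add: xa d_def)
    have eq: "D x vs = D' x vs" "D a vs = D' a vs"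
      using Cons.IH xW a by auto
    have "t * norm (D a (v # vs) - D' a (v # vs)) =
        norm ((D' x vs - D' a vs - t *\<^sub>R D' a (v # vs)) - (D x vs - D a vs - t *\<^sub>R D a (v # vs)))"
      using t by (simp add: eq flip: scaleR_diff_right)
    also have "\<dots> \<le> 2 * (c * (t * N v) * P)"
      using norm_triangle_ineq4 1 2 by (smt (verit))
    finally have "norm (D a (v # vs) - D' a (v # vs)) \<le> 2 * c * (N v * P)"
      using t by (simp add: mult.assoc mult.left_commute)
    also have "\<dots> = e * ((N v * P) / (N v * P + 1))"
      using NP by (simp add: c_def divide_simps)
    also have "\<dots> \<le> e * 1"
      using e NP by (intro mult_left_mono) (auto simp: divide_simps)
    finally show ?thesis by simp
  qed
  then have "norm (D a (v # vs) - D' a (v # vs)) \<le> 0"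
    by (rule dense_ge)
  then show ?case by simp
qed

lemma has_derivative_higher_deriv:
  fixes g :: "'a::real_normed_vector \<Rightarrow> 'b::real_normed_vector"
  assumes "open U" "smooth_map UNIV norm U g" "a \<in> U"
  shows "(g has_derivative (\<lambda>v. higher_deriv UNIV norm U g a [v])) (at a)"
proof -
  define D where "D = higher_deriv UNIV norm U g"
  have D: "derivative_tower UNIV norm U g D"
    using assms(2) unfolding smooth_map_def D_def higher_deriv_def by (rule someI_ex)
  have ml: "bounded_multilinear_on UNIV norm 1 (D a)"
    using D assms(3) by (simp add: derivative_tower_def)
  have lin: "D a [b *\<^sub>R x + c *\<^sub>R y] = b *\<^sub>R D a [x] + c *\<^sub>R D a [y]" for b c x y
    using ml unfolding bounded_multilinear_on_def by fastforce
  obtain C where C: "\<And>vs. length vs = 1 \<Longrightarrow> norm (D a vs) \<le> C * prod_list (map norm vs)"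
    using ml unfolding bounded_multilinear_on_def by auto
  have bl: "bounded_linear (\<lambda>v. D a [v])"
  proof (rule bounded_linear_intro)
    show "D a [x + y] = D a [x] + D a [y]" for x y using lin[of 1 x 1 y] by simp
    show "D a [r *\<^sub>R x] = r *\<^sub>R D a [x]" for r x using lin[of r x 0 x] by simp
    show "norm (D a [x]) \<le> norm x * C" for x using C[of "[x]"] by (simp add: mult.commute)
  qed
  have "(g has_derivative (\<lambda>v. D a [v])) (at a within U)"
    unfolding has_derivative_within_alt
  proof (intro conjI bl allI impI)
    fix e :: real assume e: "0 < e"
    then obtain d where "0 < d" and d: "\<forall>x\<in>U. norm (x - a) < d \<longrightarrow> (\<forall>vs\<in>lists UNIV. length vs = 0 \<longrightarrow>
        norm (D x vs - D a vs - D a ((x - a) # vs)) \<le> e * norm (x - a) * prod_list (map norm vs))"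
    proof -
      have "\<forall>a\<in>U. \<forall>k. \<forall>e>0. \<exists>d>0. \<forall>x\<in>U. norm (x - a) < d \<longrightarrow> (\<forall>vs\<in>lists UNIV. length vs = k \<longrightarrow>
          norm (D x vs - D a vs - D a ((x - a) # vs)) \<le> e * norm (x - a) * prod_list (map norm vs))"
        using D unfolding derivative_tower_def by (elim conjE)
      from this[rule_format, OF assms(3) e, of 0] show ?thesis
        using that by blast
    qed
    have "\<forall>x\<in>U. D x [] = g x" using D by (simp add: derivative_tower_def)
    with d assms(3) have "\<forall>x\<in>U. norm (x - a) < d \<longrightarrow>
        norm (g x - g a - D a [x - a]) \<le> e * norm (x - a)" by auto
    with \<open>0 < d\<close> show "\<exists>d>0. \<forall>y\<in>U. norm (y - a) < d \<longrightarrow>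
        norm (g y - g a - D a [y - a]) \<le> e * norm (y - a)" by blast
  qed
  then show ?thesis
    unfolding D_def at_within_open[OF assms(3,1)] .
qed


section \<open>The classes of Beurling type\<close>

definition absolutely_convex :: "'a::real_vector set \<Rightarrow> bool" where
  "absolutely_convex B \<longleftrightarrow>
     (\<forall>x\<in>B. \<forall>y\<in>B. \<forall>b c. \<bar>b\<bar> + \<bar>c\<bar> \<le> 1 \<longrightarrow> b *\<^sub>R x + c *\<^sub>R y \<in> B)"

text \<open>The sets \<open>B\<close> defining the spaces \<open>E\<^sub>B = span B\<close>; nonemptiness is made explicit, as it is
  needed for the Minkowski functional to be a norm on \<open>E\<^sub>B\<close>.\<close>

definition banach_disk :: "'a::real_normed_vector set \<Rightarrow> bool" where
  "banach_disk B \<longleftrightarrow> closed B \<and> absolutely_convex B \<and> bounded B \<and> B \<noteq> {}"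

text \<open>The value \<open>0\<close> outside of \<open>E\<^sub>B\<close> is a dummy.\<close>

definition minkowski :: "'a::real_vector set \<Rightarrow> 'a \<Rightarrow> real" where
  "minkowski B x = (if x \<in> span B then Inf {t. 0 < t \<and> x \<in> (*\<^sub>R) t ` B} else 0)"

definition norm_compact :: "'a::real_vector set \<Rightarrow> ('a \<Rightarrow> real) \<Rightarrow> 'a set \<Rightarrow> bool" where
  "norm_compact V N K \<longleftrightarrow> compactin (Metric_space.mtopology V (\<lambda>x y. N (x - y))) K"

definition multilinear_norm ::
    "'a set \<Rightarrow> ('a \<Rightarrow> real) \<Rightarrow> nat \<Rightarrow> ('a list \<Rightarrow> 'b::real_normed_vector) \<Rightarrow> real" where
  "multilinear_norm V N k T =
     Sup {norm (T vs) |vs. vs \<in> lists V \<and> length vs = k \<and> (\<forall>v\<in>set vs. N v \<le> 1)}"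

text \<open>\<open>\<E>\<^sub>(\<^sub>M\<^sub>)(W, \<real>)\<close> for \<open>W\<close> open in the Banach space \<open>(V, N)\<close>\<close>

definition beurling_functions ::
    "(real \<Rightarrow> nat \<Rightarrow> real) \<Rightarrow> 'a::real_vector set \<Rightarrow> ('a \<Rightarrow> real) \<Rightarrow> 'a set \<Rightarrow> ('a \<Rightarrow> real) set" where
  "beurling_functions M V N W =
     {g. smooth_map V N W g \<and>
         (\<forall>K\<subseteq>W. norm_compact V N K \<longrightarrow>
            (\<forall>x>0. \<forall>h>0.
               bdd_above {multilinear_norm V N k (higher_deriv V N W g a) / (h ^ k * M x k)
                          |k a. a \<in> K}))}"

definition beurling_class ::
    "(real \<Rightarrow> nat \<Rightarrow> real) \<Rightarrow> 'a::real_normed_vector set \<Rightarrow> ('a \<Rightarrow> 'b::real_normed_vector) \<Rightarrow> bool"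
  where
  "beurling_class M U f \<longleftrightarrow>
     smooth_map UNIV norm U f \<and>
     (\<forall>\<alpha> B. bounded_linear \<alpha> \<and> banach_disk B \<longrightarrow>
        (\<lambda>x. \<alpha> (f x)) \<in> beurling_functions M (span B) (minkowski B) (U \<inter> span B))"

definition beurling_class_b ::
    "(real \<Rightarrow> nat \<Rightarrow> real) \<Rightarrow> 'a::real_normed_vector set \<Rightarrow> ('a \<Rightarrow> 'b::real_normed_vector) \<Rightarrow> bool"
  where
  "beurling_class_b M U f \<longleftrightarrow>
     smooth_map UNIV norm U f \<and>
     (\<forall>B K. banach_disk B \<and> K \<subseteq> U \<inter> span B \<and> norm_compact (span B) (minkowski B) K \<longrightarrow>
        (\<forall>x>0. \<forall>h>0.
           bounded {(1 / (h ^ k * M x k)) *\<^sub>R higher_deriv UNIV norm U f a vs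
                    |k a vs. a \<in> K \<and> vs \<in> lists (span B) \<and> length vs = k \<and>
                             (\<forall>v\<in>set vs. minkowski B v \<le> 1)}))"

end

theory Submission
  imports Defs
begin

text \<open>Each of the conditions is equivalent to: for every compact \<open>K \<subseteq> U\<close> and all \<open>x, h > 0\<close> the
  quotients \<open>\<parallel>f\<^sup>(\<^sup>k\<^sup>)(a)\<parallel> / (h\<^sup>k M\<^sup>x\<^sub>k)\<close>, \<open>a \<in> K\<close>, are bounded. For the two classes, one takes for \<open>B\<close>
  the unit ball, and conversely uses that the norm of \<open>E\<^sub>B\<close> dominates a multiple of the norm of \<open>E\<close>;
  the scalar version follows because weakly bounded sets are bounded. For the test sequences, the
  special choices \<open>r\<^sub>k = h\<^sup>-\<^sup>k\<close> and \<open>s\<^sub>k = 1 / m\<^sup>x\<^sub>k\<close> recover the estimate; this \<open>r\<close> is multiplicative, and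
  \<open>s\<close> satisfies the condition on \<open>s\<^sub>o\<close> with \<open>1 / m\<^sup>y\<close> in place of \<open>s\<close>, since \<open>1 / (m\<^sup>y)\<^sup>\<circ> = (1 / m\<^sup>y)\<^sub>o\<close>.\<close>

section \<open>Weakly bounded sets\<close>

definition sublinear :: "('a::real_vector \<Rightarrow> real) \<Rightarrow> bool" where
  "sublinear p \<longleftrightarrow> (\<forall>x y. p (x + y) \<le> p x + p y) \<and> (\<forall>x. \<forall>c\<ge>0. p (c *\<^sub>R x) = c * p x)"

lemma sublinearD:
  assumes "sublinear p"
  shows "p (x + y) \<le> p x + p y" "0 \<le> c \<Longrightarrow> p (c *\<^sub>R x) = c * p x"
  using assms by (auto simp: sublinear_def)

lemma sublinear_zero: "sublinear p \<Longrightarrow> p 0 = 0"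
  using sublinearD(2)[of p 0 0] by simp

lemma sublinear_ge_minus: "sublinear p \<Longrightarrow> - p (- x) \<le> p x"
  using sublinearD(1)[of p x "- x"] by (simp add: sublinear_zero)

text \<open>The reverse of \<open>scale\<close> comes from \<open>scale\<close> itself, applied with
  \<open>inverse c\<close> at \<open>c *\<^sub>R x\<close>. This suits functionals defined as
  infima, which are easily estimated from above.\<close>

lemma sublinearI:
  assumes add: "\<And>x y. p (x + y) \<le> p x + p y"
    and scale: "\<And>c x. 0 < c \<Longrightarrow> p (c *\<^sub>R x) \<le> c * p x"
    and zero: "p 0 = 0"
  shows "sublinear p"
  unfolding sublinear_def
proof (intro conjI allI impI add)
  fix c :: real and x assume "0 \<le> c"
  show "p (c *\<^sub>R x) = c * p x"
  proof (cases "c = 0")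
    case False
    with \<open>0 \<le> c\<close> have c: "0 < c" by simp
    have "p x \<le> inverse c * p (c *\<^sub>R x)"
      using scale[of "inverse c" "c *\<^sub>R x"] c by simp
    then have "c * p x \<le> p (c *\<^sub>R x)"
      using c by (simp add: field_simps)
    with scale[OF c] show ?thesis by (simp add: antisym)
  qed (simp add: zero)
qed

text \<open>Minimizing along the ray in direction \<open>y\<close>, with the growth
  \<open>t * p y\<close> subtracted, pushes the value at \<open>- y\<close> down to
  \<open>- p y\<close>, as \<open>t = 1\<close> shows. For a minimal functional this yields oddness;
  for the norm it yields a norming functional.\<close>

lemma sublinear_shear:
  assumes p: "sublinear p"
  obtains q where "sublinear q" "\<And>x. q x \<le> p x" "q (- y) \<le> - p y"
proof
  define q where "q x = (INF t\<in>{0..}. p (x + t *\<^sub>R y) - t * p y)" for x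
  \<comment> \<open>Subadditivity bounds the family from below independently of \<open>t\<close>, so
    the infimum is a genuine one.\<close>
  have lower: "- p (- x) \<le> p (x + t *\<^sub>R y) - t * p y" if "0 \<le> t" for x t
    using sublinearD(1)[OF p, of "x + t *\<^sub>R y" "- x"] sublinearD(2)[OF p that, of y]
    by simp
  then have bdd: "bdd_below ((\<lambda>t. p (x + t *\<^sub>R y) - t * p y) ` {0..})" for x
    by (auto intro!: bdd_belowI2)
  have q_le: "q x \<le> p (x + t *\<^sub>R y) - t * p y" if "0 \<le> t" for x t
    unfolding q_def using that by (intro cINF_lower bdd) auto
  have q_ge: "z \<le> q x" if "\<And>t. 0 \<le> t \<Longrightarrow> z \<le> p (x + t *\<^sub>R y) - t * p y" for x z
    unfolding q_def using that by (intro cINF_greatest) auto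
  show "q x \<le> p x" for x
    using q_le[of 0 x] by simp
  show "q (- y) \<le> - p y"
    using q_le[of 1 "- y"] by (simp add: sublinear_zero[OF p])
  show "sublinear q"
  proof (rule sublinearI)
    fix u v
    \<comment> \<open>Parameters \<open>t\<close> for \<open>u\<close> and \<open>s\<close> for
      \<open>v\<close> give the admissible parameter \<open>t + s\<close> for \<open>u + v\<close>.
      The infima are taken one after the other, first over \<open>s\<close>, then over
      \<open>t\<close>.\<close>
    have "q (u + v) - (p (u + t *\<^sub>R y) - t * p y) \<le> q v" if t: "0 \<le> t" for t
    proof (rule q_ge)
      fix s :: real assume s: "0 \<le> s"
      have "q (u + v) \<le> p ((u + t *\<^sub>R y) + (v + s *\<^sub>R y)) - (t + s) * p y"
        using q_le[of "t + s" "u + v"] t s by (simp add: algebra_simps)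
      also have "\<dots> \<le> p (u + t *\<^sub>R y) + p (v + s *\<^sub>R y) - (t + s) * p y"
        using sublinearD(1)[OF p] by simp
      finally show "q (u + v) - (p (u + t *\<^sub>R y) - t * p y) \<le> p (v + s *\<^sub>R y) - s * p y"
        by (simp add: algebra_simps)
    qed
    then have "q (u + v) - q v \<le> q u"
      by (intro q_ge) (simp add: algebra_simps)
    then show "q (u + v) \<le> q u + q v" by simp
  next
    fix c :: real and x assume c: "0 < c"
    have "q (c *\<^sub>R x) / c \<le> q x"
    proof (rule q_ge)
      fix t :: real assume t: "0 \<le> t"
      have "q (c *\<^sub>R x) \<le> p (c *\<^sub>R (x + t *\<^sub>R y)) - (c * t) * p y"
        using q_le[of "c * t" "c *\<^sub>R x"] c t by (simp add: algebra_simps)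
      also have "\<dots> = c * (p (x + t *\<^sub>R y) - t * p y)"
        using c by (simp add: sublinearD(2)[OF p] algebra_simps del: scaleR_add_right)
      finally show "q (c *\<^sub>R x) / c \<le> p (x + t *\<^sub>R y) - t * p y"
        using c by (simp add: field_simps)
    qed
    then show "q (c *\<^sub>R x) \<le> c * q x"
      using c by (simp add: field_simps)
  next
    show "q 0 = 0"
      using q_le[of 0 0] q_ge[of 0 0] lower[of _ 0] by (simp add: sublinear_zero[OF p])
  qed
qed

text \<open>A minimal sublinear functional below \<open>p\<close> coincides with all its shears, so it is odd.\<close>

theorem sublinear_dominates_linear:
  assumes p: "sublinear p"
  obtains q where "linear q" "\<And>x. q x \<le> p x"
proof -
  define A where "A = {q. sublinear q \<and> (\<forall>x. q x \<le> p x)}"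
  \<comment> \<open>The order is reversed, so the maximal element supplied by Zorn's lemma is a
    pointwise minimal functional, and chains need lower bounds.\<close>
  define P :: "('a \<Rightarrow> real) \<Rightarrow> ('a \<Rightarrow> real) \<Rightarrow> bool" where "P = (\<lambda>a b. \<forall>x. b x \<le> a x)"
  have pA: "p \<in> A" using p by (simp add: A_def)
  have "\<exists>m\<in>A. \<forall>a\<in>A. P m a \<longrightarrow> a = m"
  proof (rule predicate_Zorn)
    show "partial_order_on A (relation_of P A)"
      by (rule partial_order_on_relation_ofI) (auto simp: P_def intro: order_trans intro!: ext antisym)
  next
    fix C assume "C \<in> Chains (relation_of P A)"
    then have CA: "C \<subseteq> A" and ch: "\<And>a b. a \<in> C \<Longrightarrow> b \<in> C \<Longrightarrow> P a b \<or> P b a"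
      by (auto simp: Chains_def relation_of_def)
    show "\<exists>u\<in>A. \<forall>a\<in>C. P a u"
    proof (cases "C = {}")
      case True
      then show ?thesis using pA by blast
    next
      case False
      define u where "u x = (INF q\<in>C. q x)" for x
      have sub: "sublinear q" and le: "q x \<le> p x" if "q \<in> C" for q x
        using that CA by (auto simp: A_def)
      \<comment> \<open>All members of the chain have the common lower bound
        \<open>- p (- x)\<close> at \<open>x\<close>, so their pointwise infimum is
        real-valued.\<close>
      have "- p (- x) \<le> q x" if "q \<in> C" for q x
        using sublinear_ge_minus[OF sub[OF that], of x] le[OF that, of "- x"] by simp
      then have bdd: "bdd_below ((\<lambda>q. q x) ` C)" for x
        by (auto intro!: bdd_belowI2)
      have u_le: "u x \<le> q x" if "q \<in> C" for q x
        unfolding u_def using that by (intro cINF_lower bdd)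
      have u_ge: "z \<le> u x" if "\<And>q. q \<in> C \<Longrightarrow> z \<le> q x" for x z
        unfolding u_def using that False by (intro cINF_greatest)
      have "sublinear u"
      proof (rule sublinearI)
        fix x y
        have *: "u (x + y) \<le> a x + b y" if ab: "a \<in> C" "b \<in> C" for a b
        proof -
          \<comment> \<open>Of two members of a chain one lies below the other; this one serves both
            arguments at once.\<close>
          obtain c where c: "c \<in> C" "c x \<le> a x" "c y \<le> b y"
            using ch[OF ab] ab unfolding P_def by blast
          show ?thesis
            using u_le[OF c(1), of "x + y"] sublinearD(1)[OF sub[OF c(1)], of x y] c by simp
        qed
        have "u (x + y) - a x \<le> u y" if "a \<in> C" for a
          using *[OF that] by (intro u_ge) (simp add: algebra_simps)
        then have "u (x + y) - u y \<le> u x"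
          by (intro u_ge) (simp add: algebra_simps)
        then show "u (x + y) \<le> u x + u y" by simp
      next
        fix c :: real and x assume c: "0 < c"
        have "u (c *\<^sub>R x) / c \<le> u x"
        proof (rule u_ge)
          fix q assume q: "q \<in> C"
          show "u (c *\<^sub>R x) / c \<le> q x"
            using u_le[OF q, of "c *\<^sub>R x"] sublinearD(2)[OF sub[OF q], of c x] c
            by (simp add: field_simps)
        qed
        then show "u (c *\<^sub>R x) \<le> c * u x"
          using c by (simp add: field_simps)
      next
        show "u 0 = 0"
          unfolding u_def using False by (simp add: sublinear_zero[OF sub] cong: INF_cong)
      qed
      moreover have "u x \<le> p x" for x
        using False u_le le by (meson all_not_in_conv order_trans)
      ultimately show ?thesis
        using u_le by (auto simp: A_def P_def)
    qed
  qed
  then obtain m where m: "sublinear m" "\<And>x. m x \<le> p x"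
    and min: "\<And>a. sublinear a \<Longrightarrow> (\<And>x. a x \<le> m x) \<Longrightarrow> a = m"
    unfolding A_def P_def by (auto, metis order_trans)
  have odd: "m (- y) = - m y" for y
  proof -
    obtain q where "sublinear q" "\<And>x. q x \<le> m x" "q (- y) \<le> - m y"
      using sublinear_shear[OF m(1)] by blast
    then have "m (- y) \<le> - m y" using min by blast
    then show ?thesis using sublinear_ge_minus[OF m(1), of y] by simp
  qed
  \<comment> \<open>Oddness turns subadditivity at \<open>x + y\<close> and \<open>- y\<close> into
    superadditivity, and extends homogeneity to negative scalars.\<close>
  have "linear m"
  proof (rule linearI)
    fix x y
    have "m x \<le> m (x + y) - m y"
      using sublinearD(1)[OF m(1), of "x + y" "- y"] odd by simp
    then show "m (x + y) = m x + m y"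
      using sublinearD(1)[OF m(1), of x y] by simp
  next
    fix c x
    show "m (c *\<^sub>R x) = c *\<^sub>R m x"
    proof (cases "0 \<le> c")
      case True
      then show ?thesis using sublinearD(2)[OF m(1)] by simp
    next
      case False
      then have "m ((- c) *\<^sub>R x) = (- c) * m x"
        by (intro sublinearD(2)[OF m(1)]) simp
      then show ?thesis using odd[of "c *\<^sub>R x"] by simp
    qed
  qed
  with m(2) show ?thesis by (rule that[rotated])
qed

text \<open>The norm is sheared in direction \<open>v\<close> before the linear functional is chosen
  below it, so the value at \<open>- v\<close> is at most \<open>- norm v\<close>.\<close>

corollary norming_functional:
  fixes v :: "'a::real_normed_vector"
  obtains \<alpha> :: "'a \<Rightarrow>\<^sub>L real" where "\<And>x. \<bar>\<alpha> x\<bar> \<le> norm x" "norm v \<le> \<bar>\<alpha> v\<bar>"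
proof -
  have "sublinear (norm :: 'a \<Rightarrow> real)"
    by (rule sublinearI) (auto simp: norm_triangle_ineq)
  then obtain p where p: "sublinear p" "\<And>x. p x \<le> norm x" "p (- v) \<le> - norm v"
    using sublinear_shear by blast
  obtain q where q: "linear q" "\<And>x. q x \<le> p x"
    using sublinear_dominates_linear[OF p(1)] by blast
  have neg: "q (- x) = - q x" for x
    using q(1) by (rule linear_neg)
  have abs: "\<bar>q x\<bar> \<le> norm x" for x
    using q(2)[of x] q(2)[of "- x"] p(2)[of x] p(2)[of "- x"] neg[of x] by simp
  have "bounded_linear q"
    using q(1) abs by (intro bounded_linear_intro[where K = 1]) (auto simp: linear_add linear_scale)
  then have "blinfun_apply (Blinfun q) = q"
    by (rule bounded_linear_Blinfun_apply)
  moreover have "norm v \<le> \<bar>q v\<bar>"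
    using q(2)[of "- v"] p(3) neg[of v] by simp
  ultimately show ?thesis
    using abs by (intro that[of "Blinfun q"]) auto
qed

text \<open>Uniform boundedness by the Baire category theorem on the dual, which is complete even if
  the space is not: the sets \<open>G n\<close> are closed and exhaust the dual, so one of them
  contains a ball.\<close>

theorem weakly_bounded_imp_bounded:
  fixes A :: "'a::real_normed_vector set"
  assumes "\<And>\<alpha> :: 'a \<Rightarrow> real. bounded_linear \<alpha> \<Longrightarrow> bounded (\<alpha> ` A)"
  shows "bounded A"
proof -
  define G :: "nat \<Rightarrow> ('a \<Rightarrow>\<^sub>L real) set" where "G n = {\<alpha>. \<forall>a\<in>A. \<bar>blinfun_apply \<alpha> a\<bar> \<le> real n}" for n
  have closed: "closed (G n)" for n
  proof -
    have "G n = (\<Inter>a\<in>A. {\<alpha>. \<bar>blinfun_apply \<alpha> a\<bar> \<le> real n})"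
      by (auto simp: G_def)
    then show ?thesis
      by (auto intro!: closed_INT closed_Collect_le continuous_intros)
  qed
  have "(\<Union>n. G n) = UNIV"
  proof -
    have "\<exists>n. \<alpha> \<in> G n" for \<alpha>
    proof -
      have "bounded (blinfun_apply \<alpha> ` A)"
        by (rule assms) (rule blinfun.bounded_linear_right)
      then obtain b where b: "\<And>a. a \<in> A \<Longrightarrow> \<bar>\<alpha> a\<bar> \<le> b"
        by (auto simp: bounded_iff)
      obtain n where "b \<le> real n" using real_arch_simple by blast
      with b have "\<alpha> \<in> G n" by (force simp: G_def)
      then show ?thesis ..
    qed
    then show ?thesis by blast
  qed
  then have "euclidean interior_of (\<Union>(range G)) \<noteq> {}"
    by simp
  moreover have "completely_metrizable_space (euclidean :: ('a \<Rightarrow>\<^sub>L real) topology)"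
    by (rule completely_metrizable_space_euclidean)
  ultimately obtain n where "interior (G n) \<noteq> {}"
    using Baire_category_alt[of euclidean "range G"] closed by auto
  then obtain \<alpha> e where e: "0 < e" and ball: "cball \<alpha> e \<subseteq> G n"
    by (auto simp: mem_interior_cball)
  have "norm a \<le> 2 * real n / e" if a: "a \<in> A" for a
  proof -
    \<comment> \<open>Moving from the centre \<open>\<alpha>\<close> by \<open>e\<close> times a
      functional norming \<open>a\<close> stays in the ball, so the difference of the two values at
      \<open>a\<close> controls \<open>e * norm a\<close>.\<close>
    obtain \<beta> :: "'a \<Rightarrow>\<^sub>L real" where \<beta>: "\<And>x. \<bar>\<beta> x\<bar> \<le> norm x" "norm a \<le> \<bar>\<beta> a\<bar>"
      by (rule norming_functional[of a]) blast
    have "norm \<beta> \<le> 1"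
      using \<beta>(1) by (intro norm_blinfun_bound) auto
    then have "\<alpha> + e *\<^sub>R \<beta> \<in> cball \<alpha> e"
      using e by (simp add: dist_norm mult_left_le)
    then have 1: "\<bar>\<alpha> a + e * \<beta> a\<bar> \<le> real n"
      using ball a by (auto simp: G_def blinfun.add_left blinfun.scaleR_left)
    have "\<alpha> \<in> G n"
      using ball e by (auto simp: less_imp_le)
    with a have 2: "\<bar>\<alpha> a\<bar> \<le> real n"
      by (simp add: G_def)
    have "e * norm a \<le> e * \<bar>\<beta> a\<bar>"
      using \<beta>(2) e by simp
    also have "\<dots> = \<bar>(\<alpha> a + e * \<beta> a) - \<alpha> a\<bar>"
      using e by (simp add: abs_mult)
    also have "\<dots> \<le> 2 * real n"
      using 1 2 by linarith
    finally show ?thesis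
      using e by (simp add: field_simps)
  qed
  then show ?thesis by (auto simp: bounded_iff)
qed

section \<open>The spaces generated by disks\<close>

lemma absolutely_convexD:
  "absolutely_convex B \<Longrightarrow> x \<in> B \<Longrightarrow> y \<in> B \<Longrightarrow> \<bar>b\<bar> + \<bar>c\<bar> \<le> 1 \<Longrightarrow> b *\<^sub>R x + c *\<^sub>R y \<in> B"
  by (simp add: absolutely_convex_def)

lemma absolutely_convex_scaleR:
  "absolutely_convex B \<Longrightarrow> x \<in> B \<Longrightarrow> \<bar>c\<bar> \<le> 1 \<Longrightarrow> c *\<^sub>R x \<in> B"
  using absolutely_convexD[of B x x c 0] by simp

text \<open>The positive multiples of elements of \<open>B\<close> already form a subspace: a sum
  with factors \<open>t\<close> and \<open>s\<close> is \<open>t + s\<close> times a convex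
  combination.\<close>

lemma span_absolutely_convexE:
  assumes B: "absolutely_convex B" "B \<noteq> {}" and x: "x \<in> span B"
  obtains t b where "0 < t" "b \<in> B" "x = t *\<^sub>R b"
proof -
  define S where "S = {x. \<exists>t>0. \<exists>b\<in>B. x = t *\<^sub>R b}"
  have "span B \<subseteq> S"
  proof (rule span_minimal)
    show "subspace S"
    proof (rule subspaceI)
      obtain b where "b \<in> B" using B(2) by blast
      then have "0 \<in> B" using absolutely_convex_scaleR[OF B(1), of b 0] by simp
      then show "0 \<in> S" unfolding S_def by (auto intro: exI[of _ 1])
    next
      fix x y assume "x \<in> S" "y \<in> S"
      then obtain t b s c where
        tb: "0 < t" "b \<in> B" "x = t *\<^sub>R b" and sc: "0 < s" "c \<in> B" "y = s *\<^sub>R c"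
        by (auto simp: S_def)
      have "(t / (t + s)) *\<^sub>R b + (s / (t + s)) *\<^sub>R c \<in> B"
        using tb sc by (intro absolutely_convexD[OF B(1)]) (simp_all flip: add_divide_distrib)
      moreover have "x + y = (t + s) *\<^sub>R ((t / (t + s)) *\<^sub>R b + (s / (t + s)) *\<^sub>R c)"
        using tb sc by (simp add: scaleR_add_right)
      ultimately show "x + y \<in> S"
        unfolding S_def using tb(1) sc(1) by (auto intro!: exI[of _ "t + s"])
    next
      fix c x assume "x \<in> S"
      then obtain t b where tb: "0 < t" "b \<in> B" "x = t *\<^sub>R b" by (auto simp: S_def)
      \<comment> \<open>The summand 1 keeps the factor positive for \<open>c = 0\<close>, while
        \<open>c * t / T\<close> still has modulus at most 1.\<close>
      define T where "T = \<bar>c\<bar> * t + 1"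
      have T: "0 < T" using tb(1) by (simp add: T_def add_nonneg_pos)
      have "(c * t / T) *\<^sub>R b \<in> B"
        using T tb by (intro absolutely_convex_scaleR[OF B(1)]) (auto simp: abs_mult T_def)
      moreover have "c *\<^sub>R x = T *\<^sub>R ((c * t / T) *\<^sub>R b)"
        using T tb by simp
      ultimately show "c *\<^sub>R x \<in> S"
        unfolding S_def using T by blast
    qed
    show "B \<subseteq> S"
    proof
      fix x assume "x \<in> B"
      then have "0 < (1 :: real) \<and> x \<in> B \<and> x = 1 *\<^sub>R x" by simp
      then show "x \<in> S" unfolding S_def by blast
    qed
  qed
  with x have "x \<in> S" by blast
  then show ?thesis using that unfolding S_def by blast
qed

lemma minkowski_le:
  assumes "0 < t" "b \<in> B"
  shows "minkowski B (t *\<^sub>R b) \<le> t"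
proof -
  have "t *\<^sub>R b \<in> span B" using assms by (simp add: span_base span_scale)
  then show ?thesis
    unfolding minkowski_def using assms
    by (auto intro!: cInf_lower bdd_belowI[where m = 0])
qed

text \<open>Some factor \<open>s < t\<close> occurs in the set defining the infimum, and
  \<open>s / t\<close> is absorbed into the element of \<open>B\<close>. Inequalities are then
  proved for every \<open>t\<close> above the functional and passed to the limit by
  \<open>dense_ge\<close>, without a minimizer.\<close>

lemma minkowski_lessE:
  assumes B: "absolutely_convex B" "B \<noteq> {}" and x: "x \<in> span B" and t: "minkowski B x < t"
  obtains b where "0 < t" "b \<in> B" "x = t *\<^sub>R b"
proof -
  have "{t. 0 < t \<and> x \<in> (*\<^sub>R) t ` B} \<noteq> {}"
    by (rule span_absolutely_convexE[OF B x]) blast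
  moreover have "Inf {t. 0 < t \<and> x \<in> (*\<^sub>R) t ` B} < t"
    using x t by (simp add: minkowski_def)
  ultimately have "\<exists>s\<in>{t. 0 < t \<and> x \<in> (*\<^sub>R) t ` B}. s < t"
    by (rule cInf_lessD)
  then obtain s b where s: "0 < s" "s < t" "b \<in> B" "x = s *\<^sub>R b"
    by blast
  have "(s / t) *\<^sub>R b \<in> B"
    using s by (intro absolutely_convex_scaleR[OF B(1)]) auto
  moreover have "x = t *\<^sub>R ((s / t) *\<^sub>R b)" using s by simp
  ultimately show ?thesis using that s by auto
qed

text \<open>Nonnegativity and homogeneity range over the whole type, which spares membership
  conditions on arguments; \<open>minkowski\<close> complies because it vanishes outside the
  span.\<close>

definition norm_on :: "'a::real_vector set \<Rightarrow> ('a \<Rightarrow> real) \<Rightarrow> bool" where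
  "norm_on V N \<longleftrightarrow> subspace V \<and> (\<forall>x. 0 \<le> N x) \<and> (\<forall>x\<in>V. N x = 0 \<longrightarrow> x = 0) \<and>
     (\<forall>x c. N (c *\<^sub>R x) = \<bar>c\<bar> * N x) \<and> (\<forall>x\<in>V. \<forall>y\<in>V. N (x + y) \<le> N x + N y)"

lemma norm_onD:
  assumes "norm_on V N"
  shows "subspace V" "0 \<le> N x" "x \<in> V \<Longrightarrow> N x = 0 \<Longrightarrow> x = 0"
    "N (c *\<^sub>R x) = \<bar>c\<bar> * N x" "x \<in> V \<Longrightarrow> y \<in> V \<Longrightarrow> N (x + y) \<le> N x + N y"
  using assms by (simp_all add: norm_on_def)

lemma norm_on_zero: "norm_on V N \<Longrightarrow> N 0 = 0"
  using norm_onD(4)[of V N 0 0] by simp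

lemma minkowski_nonneg:
  assumes B: "absolutely_convex B" "B \<noteq> {}"
  shows "0 \<le> minkowski B x"
proof (cases "x \<in> span B")
  case True
  show ?thesis
  proof (rule dense_ge)
    fix t assume "minkowski B x < t"
    then obtain b where "0 < t" "b \<in> B" "x = t *\<^sub>R b"
      by (rule minkowski_lessE[OF B True])
    then show "0 \<le> t" by simp
  qed
qed (simp add: minkowski_def)

lemma norm_le_minkowski:
  assumes B: "absolutely_convex B" "B \<noteq> {}" and R: "0 < R" "\<And>b. b \<in> B \<Longrightarrow> norm b \<le> R"
    and x: "x \<in> span B"
  shows "norm x \<le> R * minkowski B x"
proof -
  have "norm x / R \<le> minkowski B x"
  proof (rule dense_ge)
    fix t assume "minkowski B x < t"
    then obtain b where b: "0 < t" "b \<in> B" "x = t *\<^sub>R b"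
      by (rule minkowski_lessE[OF B x])
    then show "norm x / R \<le> t"
      using R(1) R(2)[OF b(2)] by (simp add: field_simps mult_left_mono)
  qed
  then show ?thesis using R(1) by (simp add: field_simps)
qed

text \<open>Absolute convexity gives the seminorm properties; boundedness of \<open>B\<close> gives
  definiteness through \<open>norm_le_minkowski\<close>.\<close>

lemma norm_on_minkowski:
  assumes "banach_disk B"
  shows "norm_on (span B) (minkowski B)"
proof -
  have B: "absolutely_convex B" "B \<noteq> {}" and bdd: "bounded B"
    using assms by (auto simp: banach_disk_def)
  obtain R where R: "0 < R" "\<And>b. b \<in> B \<Longrightarrow> norm b \<le> R"
    using bdd bounded_pos by blast
  have scale_le: "minkowski B (c *\<^sub>R x) \<le> \<bar>c\<bar> * minkowski B x" if x: "x \<in> span B" and c: "c \<noteq> 0" for c x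
  proof -
    have "minkowski B (c *\<^sub>R x) / \<bar>c\<bar> \<le> minkowski B x"
    proof (rule dense_ge)
      fix t assume "minkowski B x < t"
      then obtain b where b: "0 < t" "b \<in> B" "x = t *\<^sub>R b"
        by (rule minkowski_lessE[OF B x])
      \<comment> \<open>The sign of \<open>c\<close> is absorbed into the element of
        \<open>B\<close> and only its modulus changes the factor.\<close>
      have "sgn c *\<^sub>R b \<in> B"
        using b by (intro absolutely_convex_scaleR[OF B(1)]) (auto simp: abs_sgn_eq)
      then have "minkowski B ((\<bar>c\<bar> * t) *\<^sub>R (sgn c *\<^sub>R b)) \<le> \<bar>c\<bar> * t"
        using b c by (intro minkowski_le) auto
      moreover have "(\<bar>c\<bar> * t) * sgn c = c * t"
        by (simp add: abs_sgn sgn_if)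
      then have "(\<bar>c\<bar> * t) *\<^sub>R (sgn c *\<^sub>R b) = c *\<^sub>R x"
        using b by simp
      ultimately show "minkowski B (c *\<^sub>R x) / \<bar>c\<bar> \<le> t"
        using c by (simp add: field_simps)
    qed
    then show ?thesis using c by (simp add: field_simps)
  qed
  have zero: "minkowski B 0 = 0"
  proof (rule antisym)
    have "0 \<in> B" using absolutely_convex_scaleR[OF B(1), of _ 0] B(2) by auto
    then have "minkowski B 0 \<le> t" if "0 < t" for t
      using minkowski_le[OF that, of 0 B] by simp
    then show "minkowski B 0 \<le> 0" by (rule dense_ge)
  qed (rule minkowski_nonneg[OF B])
  show ?thesis
    unfolding norm_on_def
  proof (intro conjI ballI allI impI subspace_span)
    fix x y assume x: "x \<in> span B" and y: "y \<in> span B"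
    have "minkowski B (x + y) - minkowski B y \<le> minkowski B x"
    proof (rule dense_ge)
      fix t assume "minkowski B x < t"
      then obtain b where b: "0 < t" "b \<in> B" "x = t *\<^sub>R b"
        by (rule minkowski_lessE[OF B x])
      have "minkowski B (x + y) - t \<le> minkowski B y"
      proof (rule dense_ge)
        fix s assume "minkowski B y < s"
        then obtain c where c: "0 < s" "c \<in> B" "y = s *\<^sub>R c"
          by (rule minkowski_lessE[OF B y])
        have "(t / (t + s)) *\<^sub>R b + (s / (t + s)) *\<^sub>R c \<in> B"
          using b c by (intro absolutely_convexD[OF B(1)]) (simp_all flip: add_divide_distrib)
        then have "minkowski B ((t + s) *\<^sub>R ((t / (t + s)) *\<^sub>R b + (s / (t + s)) *\<^sub>R c)) \<le> t + s"
          using b c by (intro minkowski_le) auto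
        moreover have "x + y = (t + s) *\<^sub>R ((t / (t + s)) *\<^sub>R b + (s / (t + s)) *\<^sub>R c)"
          using b c by (simp add: scaleR_add_right)
        ultimately show "minkowski B (x + y) - t \<le> s" by simp
      qed
      then show "minkowski B (x + y) - minkowski B y \<le> t" by simp
    qed
    then show "minkowski B (x + y) \<le> minkowski B x + minkowski B y" by simp
  next
    fix x :: 'a and c :: real
    consider "c = 0" | "c \<noteq> 0" "x \<notin> span B" | "c \<noteq> 0" "x \<in> span B" by blast
    then show "minkowski B (c *\<^sub>R x) = \<bar>c\<bar> * minkowski B x"
    proof cases
      case 1
      then show ?thesis by (simp add: zero)
    next
      case 2
      then have "c *\<^sub>R x \<notin> span B"
        using span_scale[of "c *\<^sub>R x" B "inverse c"] by auto
      with 2 show ?thesis by (simp add: minkowski_def)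
    next
      case 3
      then have x: "x \<in> span B" and False: "c \<noteq> 0" by simp_all
      have "minkowski B x \<le> \<bar>inverse c\<bar> * minkowski B (c *\<^sub>R x)"
        using scale_le[of "c *\<^sub>R x" "inverse c"] x False by (simp add: span_scale)
      then have "\<bar>c\<bar> * minkowski B x \<le> minkowski B (c *\<^sub>R x)"
        using False by (simp add: field_simps)
      with scale_le[OF x False] show ?thesis by simp
    qed
  next
    fix x assume "x \<in> span B" "minkowski B x = 0"
    then show "x = 0" using norm_le_minkowski[OF B R, of x] by simp
  qed (rule minkowski_nonneg[OF B])
qed

text \<open>This is the continuity of the inclusion of \<open>span B\<close>. Compactness,
  derivatives and growth estimates are all transferred through this constant
  \<open>R\<close>.\<close>

lemma banach_disk_dominates_norm:
  assumes "banach_disk B"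
  obtains R where "0 < R" "\<And>x. x \<in> span B \<Longrightarrow> norm x \<le> R * minkowski B x"
proof -
  have "bounded B" using assms by (simp add: banach_disk_def)
  then obtain R where "0 < R" "\<And>b. b \<in> B \<Longrightarrow> norm b \<le> R"
    using bounded_pos by blast
  with assms show ?thesis
    by (intro that[of R] norm_le_minkowski) (auto simp: banach_disk_def)
qed

section \<open>The unit ball as a disk, giving back the whole space with its own norm\<close>

lemma banach_disk_unit_ball: "banach_disk (cball (0 :: 'a::real_normed_vector) 1)"
proof -
  have "norm (b *\<^sub>R x + c *\<^sub>R y) \<le> 1"
    if "norm x \<le> 1" "norm y \<le> 1" "\<bar>b\<bar> + \<bar>c\<bar> \<le> 1" for x y :: 'a and b c
  proof -
    have "norm (b *\<^sub>R x + c *\<^sub>R y) \<le> \<bar>b\<bar> * norm x + \<bar>c\<bar> * norm y"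
      using norm_triangle_ineq[of "b *\<^sub>R x" "c *\<^sub>R y"] by simp
    also have "\<dots> \<le> \<bar>b\<bar> * 1 + \<bar>c\<bar> * 1"
      using that by (intro add_mono mult_left_mono) auto
    finally show ?thesis using that by simp
  qed
  then show ?thesis by (auto simp: banach_disk_def absolutely_convex_def)
qed

lemma span_unit_ball: "span (cball (0 :: 'a::real_normed_vector) 1) = UNIV"
proof -
  have "x \<in> span (cball 0 1)" for x :: 'a
  proof -
    have "sgn x \<in> span (cball 0 1)"
      by (rule span_base) (simp add: norm_sgn)
    then have "norm x *\<^sub>R sgn x \<in> span (cball 0 1)"
      by (rule span_scale)
    then show ?thesis by (cases "x = 0") (simp_all add: sgn_div_norm span_zero)
  qed
  then show ?thesis by blast
qed

lemma minkowski_unit_ball: "minkowski (cball (0 :: 'a::real_normed_vector) 1) = norm"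
proof (rule ext, rule antisym)
  fix x :: 'a
  have disk: "banach_disk (cball (0 :: 'a) 1)" by (rule banach_disk_unit_ball)
  show "minkowski (cball 0 1) x \<le> norm x"
  proof (cases "x = 0")
    case True
    then show ?thesis using norm_on_zero[OF norm_on_minkowski[OF disk]] by simp
  next
    case False
    then have "minkowski (cball 0 1) (norm x *\<^sub>R sgn x) \<le> norm x"
      by (intro minkowski_le) (auto simp: norm_sgn)
    then show ?thesis using False by (simp add: sgn_div_norm)
  qed
  show "norm x \<le> minkowski (cball 0 1) x"
    using norm_le_minkowski[of "cball 0 1" 1 x] disk
    by (simp add: span_unit_ball banach_disk_def)
qed

section \<open>Compactness with respect to a dominating norm\<close>

lemma Metric_space_norm_on:
  assumes N: "norm_on V N"
  shows "Metric_space V (\<lambda>x y. N (x - y))"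
proof
  fix x y z
  show "0 \<le> N (x - y)" by (rule norm_onD(2)[OF N])
  show "N (x - y) = N (y - x)"
    using norm_onD(4)[OF N, of "-1" "x - y"] by simp
  assume V: "x \<in> V" "y \<in> V"
  then have "x - y \<in> V" using norm_onD(1)[OF N] by (simp add: subspace_diff)
  then show "N (x - y) = 0 \<longleftrightarrow> x = y"
    using norm_onD(3)[OF N, of "x - y"] norm_on_zero[OF N] by auto
  assume "z \<in> V"
  then show "N (x - z) \<le> N (x - y) + N (y - z)"
    using norm_onD(5)[OF N, of "x - y" "y - z"] V norm_onD(1)[OF N] by (simp add: subspace_diff)
qed

text \<open>The inclusion is Lipschitz with constant \<open>R\<close>, and continuous images of
  compact sets are compact.\<close>

lemma norm_compact_imp_compact:
  assumes N: "norm_on V N" and R: "0 < R" "\<And>x. x \<in> V \<Longrightarrow> norm x \<le> R * N x"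
    and K: "norm_compact V N K"
  shows "compact K"
proof -
  interpret Metric_space V "\<lambda>x y. N (x - y)"
    by (rule Metric_space_norm_on[OF N])
  have "continuous_map mtopology Met_TC.mtopology id"
    unfolding metric_continuous_map[OF Met_TC.Metric_space_axioms]
  proof (intro conjI ballI allI impI)
    fix a and e :: real assume a: "a \<in> V" and e: "0 < e"
    show "\<exists>d>0. \<forall>x. x \<in> V \<and> N (a - x) < d \<longrightarrow> dist (id a) (id x) < e"
    proof (intro exI[of _ "e / R"] conjI allI impI)
      show "0 < e / R" using e R by simp
      fix x assume x: "x \<in> V \<and> N (a - x) < e / R"
      then have "norm (a - x) \<le> R * N (a - x)"
        using a norm_onD(1)[OF N] by (intro R(2) subspace_diff) auto
      also have "\<dots> < e" using x R(1) by (simp add: field_simps)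
      finally show "dist (id a) (id x) < e" by (simp add: dist_norm)
    qed
  qed simp
  then have "compactin Met_TC.mtopology (id ` K)"
    using K by (intro image_compactin) (simp_all add: norm_compact_def)
  then show ?thesis by simp
qed

lemma norm_compact_UNIV: "norm_compact UNIV norm K \<longleftrightarrow> compact K"
proof -
  have "(\<lambda>x y :: 'a. norm (x - y)) = dist" by (intro ext) (simp add: dist_norm)
  then show ?thesis by (simp add: norm_compact_def)
qed

section \<open>Derivatives along the spaces generated by disks\<close>

lemma derivative_tower_higher_deriv:
  "smooth_map V N W g \<Longrightarrow> derivative_tower V N W g (higher_deriv V N W g)"
  unfolding smooth_map_def higher_deriv_def by (erule someI_ex)

lemma bounded_multilinear_on_scaleR:
  assumes V: "subspace V" and T: "bounded_multilinear_on V N k T"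
    and vs: "vs \<in> lists V" "length vs = k"
  shows "T (map ((*\<^sub>R) c) vs) = c ^ k *\<^sub>R T vs"
proof -
  \<comment> \<open>The prefix \<open>us\<close> collects the entries already scaled, since the
    multilinearity clause changes one entry between two arbitrary lists.\<close>
  have "T (us @ map ((*\<^sub>R) c) ws) = c ^ length ws *\<^sub>R T (us @ ws)"
    if "us \<in> lists V" "ws \<in> lists V" "length us + length ws = k" for us ws
    using that
  proof (induction ws arbitrary: us)
    case (Cons w ws)
    then have w: "w \<in> V" "c *\<^sub>R w \<in> V" and ws: "ws \<in> lists V"
      using V by (auto simp: subspace_scale)
    have "T (us @ map ((*\<^sub>R) c) (w # ws)) = T ((us @ [c *\<^sub>R w]) @ map ((*\<^sub>R) c) ws)"
      by simp
    also have "\<dots> = c ^ length ws *\<^sub>R T (us @ (c *\<^sub>R w) # ws)"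
      using Cons.IH[of "us @ [c *\<^sub>R w]"] Cons.prems w ws by simp
    also have "T (us @ (c *\<^sub>R w) # ws) = c *\<^sub>R T (us @ w # ws)"
    proof -
      have "\<forall>x\<in>V. \<forall>y\<in>V. \<forall>b c. T (us @ (b *\<^sub>R x + c *\<^sub>R y) # ws) =
          b *\<^sub>R T (us @ x # ws) + c *\<^sub>R T (us @ y # ws)"
        using T Cons.prems unfolding bounded_multilinear_on_def by auto
      from bspec[OF bspec[OF this w(1)] w(1), rule_format, of c 0] show ?thesis by simp
    qed
    finally show ?case by (simp add: mult.commute)
  qed simp
  from this[of "[]" vs] vs show ?thesis by simp
qed

lemma prod_list_map_nonneg: "(\<And>x. 0 \<le> N x) \<Longrightarrow> 0 \<le> prod_list (map N xs :: real list)"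
  by (induction xs) auto

lemma prod_list_map_le_power:
  assumes "\<And>x. 0 \<le> N x" "\<And>x. x \<in> set xs \<Longrightarrow> N x \<le> c"
  shows "prod_list (map N xs) \<le> (c :: real) ^ length xs"
  using assms(2)
proof (induction xs)
  case (Cons x xs)
  have "N x * prod_list (map N xs) \<le> c * c ^ length xs"
    using Cons assms(1) order_trans[OF assms(1)[of x]]
    by (intro mult_mono) (auto intro!: prod_list_map_nonneg)
  then show ?case by simp
qed simp

lemma prod_list_norm_le:
  assumes N: "norm_on V N" and R: "0 < R" "\<And>x. x \<in> V \<Longrightarrow> norm x \<le> R * N x"
    and vs: "vs \<in> lists V"
  shows "prod_list (map norm vs) \<le> R ^ length vs * prod_list (map N vs)"
  using vs
proof (induction vs)
  case (Cons v vs)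
  then have "norm v * prod_list (map norm vs) \<le> (R * N v) * (R ^ length vs * prod_list (map N vs))"
    using R norm_onD(2)[OF N]
    by (intro mult_mono) (auto intro!: prod_list_map_nonneg)
  then show ?case by (simp add: mult_ac)
qed simp

text \<open>Composing a tower with \<open>\<alpha>\<close> and restricting it to \<open>V\<close>
  costs only constant factors in the norm and remainder estimates: powers of \<open>R\<close> and a
  bound for \<open>\<alpha>\<close>.\<close>

lemma derivative_tower_restrict:
  fixes f :: "'a::real_normed_vector \<Rightarrow> 'b::real_normed_vector"
    and \<alpha> :: "'b \<Rightarrow> 'c::real_normed_vector"
  assumes D: "derivative_tower UNIV norm U f D" and \<alpha>: "bounded_linear \<alpha>"
    and N: "norm_on V N" and R: "0 < R" "\<And>x. x \<in> V \<Longrightarrow> norm x \<le> R * N x"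
  shows "derivative_tower V N (U \<inter> V) (\<lambda>x. \<alpha> (f x)) (\<lambda>a vs. \<alpha> (D a vs))"
  unfolding derivative_tower_def
proof (intro conjI ballI allI impI)
  interpret \<alpha>: bounded_linear \<alpha> by (rule \<alpha>)
  obtain A where A: "0 < A" "\<And>x. norm (\<alpha> x) \<le> norm x * A"
    using \<alpha>.pos_bounded by blast
  fix a assume a: "a \<in> U \<inter> V"
  then have aU: "a \<in> U" by simp
  show "\<alpha> (D a []) = \<alpha> (f a)"
    using D a by (simp add: derivative_tower_def)
  fix k
  have ml: "bounded_multilinear_on UNIV norm k (D a)"
    using D a by (simp add: derivative_tower_def)
  show "bounded_multilinear_on V N k (\<lambda>vs. \<alpha> (D a vs))"
    unfolding bounded_multilinear_on_def
  proof (intro conjI ballI allI impI)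
    fix us ws :: "'a list" and x y b c assume "length us + length ws + 1 = k"
    then have "D a (us @ (b *\<^sub>R x + c *\<^sub>R y) # ws) =
        b *\<^sub>R D a (us @ x # ws) + c *\<^sub>R D a (us @ y # ws)"
      using ml unfolding bounded_multilinear_on_def by auto
    then show "\<alpha> (D a (us @ (b *\<^sub>R x + c *\<^sub>R y) # ws)) =
        b *\<^sub>R \<alpha> (D a (us @ x # ws)) + c *\<^sub>R \<alpha> (D a (us @ y # ws))"
      by (simp add: \<alpha>.add \<alpha>.scaleR)
  next
    obtain C where C: "\<And>vs. length vs = k \<Longrightarrow> norm (D a vs) \<le> C * prod_list (map norm vs)"
      using ml unfolding bounded_multilinear_on_def by auto
    have "norm (\<alpha> (D a vs)) \<le> (\<bar>C\<bar> * R ^ k * A) * prod_list (map N vs)"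
      if vs: "vs \<in> lists V" "length vs = k" for vs
    proof -
      have "norm (D a vs) \<le> \<bar>C\<bar> * prod_list (map norm vs)"
        using C[OF vs(2)] by (rule order_trans) (auto intro!: mult_right_mono prod_list_map_nonneg)
      also have "\<dots> \<le> \<bar>C\<bar> * (R ^ k * prod_list (map N vs))"
        using prod_list_norm_le[OF N R vs(1)] vs(2) by (auto intro!: mult_left_mono)
      finally have "norm (D a vs) * A \<le> \<bar>C\<bar> * (R ^ k * prod_list (map N vs)) * A"
        using A(1) by simp
      with A(2)[of "D a vs"] show ?thesis by (simp add: mult_ac)
    qed
    then show "\<exists>C. \<forall>vs\<in>lists V. length vs = k \<longrightarrow> norm (\<alpha> (D a vs)) \<le> C * prod_list (map N vs)"
      by blast
  qed
  fix e :: real assume e: "0 < e"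
  \<comment> \<open>One factor \<open>R\<close> for each of the \<open>k\<close> arguments and one
    for the increment \<open>x - a\<close>; the factor \<open>A\<close> bounds
    \<open>\<alpha>\<close>.\<close>
  define e' where "e' = e / (A * R ^ Suc k)"
  have e': "0 < e'" using e A R by (simp add: e'_def)
  have "\<forall>a\<in>U. \<forall>k. \<forall>e>0. \<exists>d>0. \<forall>x\<in>U. norm (x - a) < d \<longrightarrow>
      (\<forall>vs\<in>lists UNIV. length vs = k \<longrightarrow>
        norm (D x vs - D a vs - D a ((x - a) # vs)) \<le> e * norm (x - a) * prod_list (map norm vs))"
    using D unfolding derivative_tower_def by (elim conjE)
  from this[rule_format, OF aU e', of k] obtain d where d: "0 < d" and
    rem: "\<And>x vs. x \<in> U \<Longrightarrow> norm (x - a) < d \<Longrightarrow> length vs = k \<Longrightarrow>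
        norm (D x vs - D a vs - D a ((x - a) # vs)) \<le> e' * norm (x - a) * prod_list (map norm vs)"
    by (auto simp: lists_UNIV)
  show "\<exists>d>0. \<forall>x\<in>U \<inter> V. N (x - a) < d \<longrightarrow> (\<forall>vs\<in>lists V. length vs = k \<longrightarrow>
      norm (\<alpha> (D x vs) - \<alpha> (D a vs) - \<alpha> (D a ((x - a) # vs))) \<le> e * N (x - a) * prod_list (map N vs))"
  proof (intro exI[of _ "d / R"] conjI ballI impI)
    show "0 < d / R" using d R by simp
    fix x vs assume x: "x \<in> U \<inter> V" "N (x - a) < d / R" and vs: "vs \<in> lists V" "length vs = k"
    have xa: "norm (x - a) \<le> R * N (x - a)"
      using x a norm_onD(1)[OF N] by (intro R(2) subspace_diff) auto
    also have "\<dots> < d" using x R(1) by (simp add: field_simps)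
    finally have "norm (x - a) < d" .
    let ?r = "D x vs - D a vs - D a ((x - a) # vs)"
    have "norm ?r \<le> e' * norm (x - a) * prod_list (map norm vs)"
      using x vs \<open>norm (x - a) < d\<close> by (intro rem) auto
    also have "\<dots> \<le> e' * (R * N (x - a)) * (R ^ k * prod_list (map N vs))"
      using e' xa prod_list_norm_le[OF N R vs(1)] vs(2) R(1) norm_onD(2)[OF N]
      by (intro mult_mono) (auto intro!: prod_list_map_nonneg)
    finally have "norm ?r * A \<le> e' * (R * N (x - a)) * (R ^ k * prod_list (map N vs)) * A"
      using A(1) by simp
    also have "\<dots> = (e' * (A * R ^ Suc k)) * N (x - a) * prod_list (map N vs)"
      by (simp add: mult_ac)
    also have "e' * (A * R ^ Suc k) = e"
      using A R by (simp add: e'_def)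
    finally have "norm (\<alpha> ?r) \<le> e * N (x - a) * prod_list (map N vs)"
      using A(2)[of ?r] by simp
    then show "norm (\<alpha> (D x vs) - \<alpha> (D a vs) - \<alpha> (D a ((x - a) # vs)))
        \<le> e * N (x - a) * prod_list (map N vs)"
      by (simp add: \<alpha>.diff)
  qed
qed

text \<open>The restricted tower coincides with the chosen one by uniqueness of towers, which
  applies because \<open>U \<inter> V\<close> is open for the stronger norm
  \<open>N\<close>.\<close>

lemma higher_deriv_restrict:
  fixes f :: "'a::real_normed_vector \<Rightarrow> 'b::real_normed_vector"
    and \<alpha> :: "'b \<Rightarrow> 'c::real_normed_vector"
  assumes U: "open U" and f: "smooth_map UNIV norm U f" and \<alpha>: "bounded_linear \<alpha>"
    and N: "norm_on V N" and R: "0 < R" "\<And>x. x \<in> V \<Longrightarrow> norm x \<le> R * N x"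
  shows "smooth_map V N (U \<inter> V) (\<lambda>x. \<alpha> (f x))"
    and "a \<in> U \<inter> V \<Longrightarrow> vs \<in> lists V \<Longrightarrow>
      higher_deriv V N (U \<inter> V) (\<lambda>x. \<alpha> (f x)) a vs = \<alpha> (higher_deriv UNIV norm U f a vs)"
proof -
  have D: "derivative_tower V N (U \<inter> V) (\<lambda>x. \<alpha> (f x)) (\<lambda>a vs. \<alpha> (higher_deriv UNIV norm U f a vs))"
    by (rule derivative_tower_restrict[OF derivative_tower_higher_deriv[OF f] \<alpha> N R])
  then show smooth: "smooth_map V N (U \<inter> V) (\<lambda>x. \<alpha> (f x))"
    by (auto simp: smooth_map_def)
  assume a: "a \<in> U \<inter> V" and vs: "vs \<in> lists V"
  show "higher_deriv V N (U \<inter> V) (\<lambda>x. \<alpha> (f x)) a vs = \<alpha> (higher_deriv UNIV norm U f a vs)"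
  proof (rule derivative_tower_unique[OF norm_onD(1)[OF N] _ _ _ _
        derivative_tower_higher_deriv[OF smooth] D a vs])
    fix a assume a: "a \<in> U \<inter> V"
    then obtain d where d: "0 < d" "ball a d \<subseteq> U"
      using U open_contains_ball by blast
    show "\<exists>d>0. \<forall>x\<in>V. N (x - a) < d \<longrightarrow> x \<in> U \<inter> V"
    proof (intro exI[of _ "d / R"] conjI ballI impI)
      show "0 < d / R" using d R by simp
      fix x assume x: "x \<in> V" "N (x - a) < d / R"
      have "norm (x - a) \<le> R * N (x - a)"
        using x a norm_onD(1)[OF N] by (intro R(2) subspace_diff) auto
      also have "\<dots> < d" using x R(1) by (simp add: field_simps)
      finally have "x \<in> ball a d" by (simp add: dist_norm norm_minus_commute)
      then show "x \<in> U \<inter> V" using d x by auto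
    qed
  qed (auto simp: norm_onD(2,4)[OF N])
qed

section \<open>Operator norms and bounded sets of derivatives\<close>

lemma multilinear_norm_le_iff:
  assumes N: "norm_on V N" and T: "bounded_multilinear_on V N k T"
  shows "multilinear_norm V N k T \<le> c \<longleftrightarrow>
    (\<forall>vs\<in>lists V. length vs = k \<longrightarrow> (\<forall>v\<in>set vs. N v \<le> 1) \<longrightarrow> norm (T vs) \<le> c)"
proof -
  let ?S = "{norm (T vs) |vs. vs \<in> lists V \<and> length vs = k \<and> (\<forall>v\<in>set vs. N v \<le> 1)}"
  obtain C where C: "\<And>vs. vs \<in> lists V \<Longrightarrow> length vs = k \<Longrightarrow> norm (T vs) \<le> C * prod_list (map N vs)"
    using T unfolding bounded_multilinear_on_def by blast
  have "norm (T vs) \<le> \<bar>C\<bar>" if vs: "vs \<in> lists V" "length vs = k" "\<forall>v\<in>set vs. N v \<le> 1" for vs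
  proof -
    have 1: "0 \<le> prod_list (map N vs)" "prod_list (map N vs) \<le> 1"
      using vs(3) norm_onD(2)[OF N] prod_list_map_le_power[of N vs 1]
      by (auto intro: prod_list_map_nonneg)
    have "C * prod_list (map N vs) \<le> \<bar>C\<bar> * 1"
      using 1 by (intro mult_mono) auto
    with C[OF vs(1,2)] show ?thesis by simp
  qed
  \<comment> \<open>With this bound and the admissible list of \<open>k\<close> zeros the set is
    bounded above and nonempty, so \<open>Sup\<close> is a true least upper bound.\<close>
  then have bdd: "bdd_above ?S"
    by (auto intro!: bdd_aboveI[where M = "\<bar>C\<bar>"])
  have "set (replicate k 0) \<subseteq> V"
    using subspace_0[OF norm_onD(1)[OF N]] by auto
  then have ne: "?S \<noteq> {}"
    using norm_on_zero[OF N] by (auto intro!: exI[of _ "replicate k 0"])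
  show ?thesis
    unfolding multilinear_norm_def cSup_le_iff[OF ne bdd] by blast
qed

text \<open>The order \<open>k\<close> is eliminated as the length of \<open>vs\<close>. The weight
  \<open>w\<close> stays arbitrary, to cover both the growth quotients and the products of test
  sequences.\<close>

lemma bounded_scaled_deriv_iff:
  "bounded {w k *\<^sub>R T a vs |k a vs. a \<in> K \<and> vs \<in> lists V \<and> length vs = k \<and> (\<forall>v\<in>set vs. N v \<le> 1)} \<longleftrightarrow>
    (\<exists>c. \<forall>a\<in>K. \<forall>vs\<in>lists V. (\<forall>v\<in>set vs. N v \<le> (1::real)) \<longrightarrow> \<bar>w (length vs)\<bar> * norm (T a vs) \<le> c)"
    (is "bounded ?S \<longleftrightarrow> _")
  unfolding bounded_iff
proof (intro arg_cong[where f = Ex] ext iffI ballI impI)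
  fix c a vs assume S: "\<forall>z\<in>?S. norm z \<le> c"
    and "a \<in> K" "vs \<in> lists V" "\<forall>v\<in>set vs. N v \<le> 1"
  then have "w (length vs) *\<^sub>R T a vs \<in> ?S" by blast
  with S have "norm (w (length vs) *\<^sub>R T a vs) \<le> c" by blast
  then show "\<bar>w (length vs)\<bar> * norm (T a vs) \<le> c" by simp
next
  fix c z assume T: "\<forall>a\<in>K. \<forall>vs\<in>lists V. (\<forall>v\<in>set vs. N v \<le> 1) \<longrightarrow>
      \<bar>w (length vs)\<bar> * norm (T a vs) \<le> c"
  assume "z \<in> ?S"
  then obtain a vs where "z = w (length vs) *\<^sub>R T a vs" "a \<in> K" "vs \<in> lists V"
    "\<forall>v\<in>set vs. N v \<le> 1" by blast
  with T show "norm z \<le> c" by simp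
qed

section \<open>Growth estimates on compact sets\<close>

text \<open>The common form of all the conditions, free of quotients and operator norms: one
  constant \<open>c\<close> serves all orders, the order being the length of
  \<open>vs\<close>.\<close>

definition growth_bound ::
    "(real \<Rightarrow> nat \<Rightarrow> real) \<Rightarrow> 'a::real_vector set \<Rightarrow> ('a \<Rightarrow> real) \<Rightarrow> 'a set \<Rightarrow>
     ('a \<Rightarrow> 'a list \<Rightarrow> 'b::real_normed_vector) \<Rightarrow> bool" where
  "growth_bound M V N K D \<longleftrightarrow>
     (\<forall>x>0. \<forall>h>0. \<exists>c. \<forall>a\<in>K. \<forall>vs\<in>lists V. (\<forall>v\<in>set vs. N v \<le> 1) \<longrightarrow>
        norm (D a vs) \<le> c * (h ^ length vs * M x (length vs)))"

lemma growth_boundE: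
  assumes "growth_bound M V N K D" "0 < x" "0 < h"
  obtains c where "\<forall>a\<in>K. \<forall>vs\<in>lists V. (\<forall>v\<in>set vs. N v \<le> 1) \<longrightarrow>
      norm (D a vs) \<le> c * (h ^ length vs * M x (length vs))"
  by (rule exE[OF assms(1)[unfolded growth_bound_def, rule_format, OF assms(2,3)]]) (rule that)

lemma growth_bound_iff_bounded:
  assumes M: "\<forall>x>0. \<forall>k. 0 < M x k"
  shows "growth_bound M V N K D \<longleftrightarrow>
    (\<forall>x>0. \<forall>h>0. bounded {(1 / (h ^ k * M x k)) *\<^sub>R D a vs
        |k a vs. a \<in> K \<and> vs \<in> lists V \<and> length vs = k \<and> (\<forall>v\<in>set vs. N v \<le> 1)})"
  unfolding growth_bound_def bounded_scaled_deriv_iff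
proof (intro all_cong arg_cong[where f = Ex] ext ball_cong refl imp_cong)
  fix x h c :: real and a and vs :: "'a list" assume "0 < x" "0 < h"
  then have "0 < h ^ length vs * M x (length vs)" by (simp add: M)
  then show "norm (D a vs) \<le> c * (h ^ length vs * M x (length vs)) \<longleftrightarrow>
      \<bar>1 / (h ^ length vs * M x (length vs))\<bar> * norm (D a vs) \<le> c"
    by (simp add: field_simps)
qed

lemma beurling_functions_iff:
  assumes M: "\<forall>x>0. \<forall>k. 0 < M x k" and N: "norm_on V N"
    and g: "smooth_map V N W g"
  shows "g \<in> beurling_functions M V N W \<longleftrightarrow>
    (\<forall>K\<subseteq>W. norm_compact V N K \<longrightarrow> growth_bound M V N K (higher_deriv V N W g))"
proof -
  let ?D = "higher_deriv V N W g"
  have "bdd_above {multilinear_norm V N k (?D a) / (h ^ k * M x k) |k a. a \<in> K} \<longleftrightarrow>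
      (\<exists>c. \<forall>a\<in>K. \<forall>vs\<in>lists V. (\<forall>v\<in>set vs. N v \<le> 1) \<longrightarrow>
        norm (?D a vs) \<le> c * (h ^ length vs * M x (length vs)))"
    if K: "K \<subseteq> W" and x: "0 < x" and h: "0 < h" for K x h
  proof -
    have *: "multilinear_norm V N k (?D a) / (h ^ k * M x k) \<le> c \<longleftrightarrow>
        (\<forall>vs\<in>lists V. length vs = k \<longrightarrow> (\<forall>v\<in>set vs. N v \<le> 1) \<longrightarrow>
          norm (?D a vs) \<le> c * (h ^ k * M x k))" if "a \<in> K" for k a c
    proof -
      have "bounded_multilinear_on V N k (?D a)"
        using derivative_tower_higher_deriv[OF g] that K by (auto simp: derivative_tower_def)
      moreover have "0 < h ^ k * M x k" using x h by (simp add: M)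
      ultimately show ?thesis
        by (simp add: pos_divide_le_eq multilinear_norm_le_iff[OF N])
    qed
    have "bdd_above {multilinear_norm V N k (?D a) / (h ^ k * M x k) |k a. a \<in> K} \<longleftrightarrow>
        (\<exists>c. \<forall>k. \<forall>a\<in>K. multilinear_norm V N k (?D a) / (h ^ k * M x k) \<le> c)"
      unfolding bdd_above_def by blast
    also have "\<dots> \<longleftrightarrow> (\<exists>c. \<forall>k. \<forall>a\<in>K. \<forall>vs\<in>lists V. length vs = k \<longrightarrow> (\<forall>v\<in>set vs. N v \<le> 1) \<longrightarrow>
        norm (?D a vs) \<le> c * (h ^ k * M x k))"
      using * by (simp cong: ball_cong)
    also have "\<dots> \<longleftrightarrow> (\<exists>c. \<forall>a\<in>K. \<forall>vs\<in>lists V. (\<forall>v\<in>set vs. N v \<le> 1) \<longrightarrow>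
        norm (?D a vs) \<le> c * (h ^ length vs * M x (length vs)))"
      by (intro arg_cong[where f = Ex] ext) auto
    finally show ?thesis .
  qed
  then show ?thesis
    using g by (auto simp: beurling_functions_def growth_bound_def)
qed

text \<open>By multilinearity, passing from \<open>norm\<close> to a norm with \<open>norm \<le> R * N\<close> only changes \<open>h\<close> to
  \<open>h / R\<close>.\<close>

lemma growth_bound_dominated:
  assumes ml: "\<And>a k. a \<in> K \<Longrightarrow> bounded_multilinear_on UNIV norm k (D a)"
    and N: "norm_on V N" and R: "0 < R" "\<And>x. x \<in> V \<Longrightarrow> norm x \<le> R * N x"
    and D: "growth_bound M UNIV norm K D"
  shows "growth_bound M V N K D"
  unfolding growth_bound_def
proof (intro allI impI)
  fix x h :: real assume x: "0 < x" and h: "0 < h"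
  have "0 < h / R" using h R by simp
  with D x obtain c where c: "\<forall>a\<in>K. \<forall>vs\<in>lists UNIV. (\<forall>v\<in>set vs. norm v \<le> 1) \<longrightarrow>
      norm (D a vs) \<le> c * ((h / R) ^ length vs * M x (length vs))"
    by (rule growth_boundE)
  have "norm (D a vs) \<le> c * (h ^ length vs * M x (length vs))"
    if a: "a \<in> K" and vs: "vs \<in> lists V" "\<forall>v\<in>set vs. N v \<le> 1" for a vs
  proof -
    \<comment> \<open>Dividing by \<open>R\<close> moves the arguments from the unit ball of
      \<open>N\<close> into that of \<open>norm\<close>; the resulting powers of \<open>R\<close>
      cancel against those in \<open>h / R\<close>.\<close>
    let ?ws = "map ((*\<^sub>R) (1 / R)) vs"
    have ws: "\<forall>v\<in>set ?ws. norm v \<le> 1"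
    proof
      fix w assume "w \<in> set ?ws"
      then obtain v where v: "v \<in> set vs" "w = (1 / R) *\<^sub>R v" by auto
      then have "norm v \<le> R * N v" using vs by (intro R(2)) auto
      also have "\<dots> \<le> R" using v vs R(1) by (simp add: mult_left_le)
      finally show "norm w \<le> 1" using v R(1) by simp
    qed
    from bspec[OF bspec[OF c a], of ?ws] ws have "norm (D a ?ws) \<le> c * ((h / R) ^ length vs * M x (length vs))"
      by (simp only: lists_UNIV UNIV_I length_map)
    also have "D a ?ws = (1 / R) ^ length vs *\<^sub>R D a vs"
      by (rule bounded_multilinear_on_scaleR[OF subspace_UNIV ml[OF a]]) auto
    also have "norm ((1 / R) ^ length vs *\<^sub>R D a vs) = norm (D a vs) / R ^ length vs"
      using R(1) by (simp add: power_divide)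
    also have "c * ((h / R) ^ length vs * M x (length vs)) =
        c * (h ^ length vs * M x (length vs)) / R ^ length vs"
      by (simp add: power_divide)
    finally show ?thesis
      using R(1) by (simp add: divide_le_cancel)
  qed
  then show "\<exists>c. \<forall>a\<in>K. \<forall>vs\<in>lists V. (\<forall>v\<in>set vs. N v \<le> 1) \<longrightarrow>
      norm (D a vs) \<le> c * (h ^ length vs * M x (length vs))" by blast
qed

lemma growth_bound_bounded_linear:
  assumes \<alpha>: "bounded_linear \<alpha>" and D: "growth_bound M V N K D"
  shows "growth_bound M V N K (\<lambda>a vs. \<alpha> (D a vs))"
  unfolding growth_bound_def
proof (intro allI impI)
  obtain A where A: "0 < A" "\<And>x. norm (\<alpha> x) \<le> norm x * A"
    using bounded_linear.pos_bounded[OF \<alpha>] by blast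
  fix x h :: real assume xh: "0 < x" "0 < h"
  obtain c where c: "\<forall>a\<in>K. \<forall>vs\<in>lists V. (\<forall>v\<in>set vs. N v \<le> 1) \<longrightarrow>
      norm (D a vs) \<le> c * (h ^ length vs * M x (length vs))"
    by (rule growth_boundE[OF D xh])
  have "norm (\<alpha> (D a vs)) \<le> (c * A) * (h ^ length vs * M x (length vs))"
    if "a \<in> K" "vs \<in> lists V" "\<forall>v\<in>set vs. N v \<le> 1" for a vs
  proof -
    have "norm (D a vs) * A \<le> c * (h ^ length vs * M x (length vs)) * A"
      using c[rule_format, OF that(1,2)] that(3) A(1) by simp
    with A(2)[of "D a vs"] show ?thesis by (simp add: mult_ac)
  qed
  then show "\<exists>c. \<forall>a\<in>K. \<forall>vs\<in>lists V. (\<forall>v\<in>set vs. N v \<le> 1) \<longrightarrow>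
      norm (\<alpha> (D a vs)) \<le> c * (h ^ length vs * M x (length vs))" by blast
qed

text \<open>For fixed \<open>x\<close> and \<open>h\<close> the estimate is boundedness of a single
  set, which may be tested by functionals.\<close>

lemma growth_bound_weak:
  assumes M: "\<forall>x>0. \<forall>k. 0 < M x k"
    and D: "\<And>\<alpha> :: 'b::real_normed_vector \<Rightarrow> real. bounded_linear \<alpha> \<Longrightarrow>
      growth_bound M V N K (\<lambda>a vs. \<alpha> (D a vs))"
  shows "growth_bound M V N K (D :: 'a::real_vector \<Rightarrow> 'a list \<Rightarrow> 'b)"
  unfolding growth_bound_iff_bounded[OF M]
proof (intro allI impI, rule weakly_bounded_imp_bounded)
  fix x h :: real and \<alpha> :: "'b \<Rightarrow> real" assume xh: "0 < x" "0 < h" and \<alpha>: "bounded_linear \<alpha>"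
  have "bounded {(1 / (h ^ k * M x k)) *\<^sub>R \<alpha> (D a vs)
      |k a vs. a \<in> K \<and> vs \<in> lists V \<and> length vs = k \<and> (\<forall>v\<in>set vs. N v \<le> 1)}"
    using D[OF \<alpha>] xh by (simp add: growth_bound_iff_bounded[OF M])
  then show "bounded (\<alpha> ` {(1 / (h ^ k * M x k)) *\<^sub>R D a vs
      |k a vs. a \<in> K \<and> vs \<in> lists V \<and> length vs = k \<and> (\<forall>v\<in>set vs. N v \<le> 1)})"
  proof (rule bounded_subset, intro image_subsetI)
    fix z assume "z \<in> {(1 / (h ^ k * M x k)) *\<^sub>R D a vs
      |k a vs. a \<in> K \<and> vs \<in> lists V \<and> length vs = k \<and> (\<forall>v\<in>set vs. N v \<le> 1)}"
    then obtain k a vs where z: "z = (1 / (h ^ k * M x k)) *\<^sub>R D a vs"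
      and *: "a \<in> K" "vs \<in> lists V" "length vs = k" "\<forall>v\<in>set vs. N v \<le> 1"
      by blast
    have "\<alpha> z = (1 / (h ^ k * M x k)) *\<^sub>R \<alpha> (D a vs)"
      unfolding z by (rule linear_scale[OF bounded_linear.linear[OF \<alpha>]])
    with * show "\<alpha> z \<in> {(1 / (h ^ k * M x k)) *\<^sub>R \<alpha> (D a vs)
      |k a vs. a \<in> K \<and> vs \<in> lists V \<and> length vs = k \<and> (\<forall>v\<in>set vs. N v \<le> 1)}"
      by blast
  qed
qed

text \<open>Both classes are characterized by the same condition, stated with the norm of the space
  alone; this is how they are seen to agree.\<close>

lemma beurling_class_iff:
  fixes f :: "'a::real_normed_vector \<Rightarrow> 'b::real_normed_vector"
  assumes M: "\<forall>x>0. \<forall>k. 0 < M x k" and U: "open U" and f: "smooth_map UNIV norm U f"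
  defines "D \<equiv> higher_deriv UNIV norm U f"
  shows "beurling_class M U f \<longleftrightarrow> (\<forall>K\<subseteq>U. compact K \<longrightarrow> growth_bound M UNIV norm K D)"
    and "beurling_class_b M U f \<longleftrightarrow> (\<forall>K\<subseteq>U. compact K \<longrightarrow> growth_bound M UNIV norm K D)"
proof -
  let ?Q = "\<forall>K\<subseteq>U. compact K \<longrightarrow> growth_bound M UNIV norm K D"
  \<comment> \<open>The two derivatives are compared only at points of \<open>K\<close> and on lists
    in \<open>V\<close>, which is all that \<open>growth_bound\<close> looks at.\<close>
  have cong: "growth_bound M V N K (higher_deriv V N (U \<inter> V) (\<lambda>x. \<alpha> (f x))) \<longleftrightarrow>
      growth_bound M V N K (\<lambda>a vs. \<alpha> (D a vs))"
    if \<alpha>: "bounded_linear \<alpha>" and N: "norm_on V N"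
      and R: "0 < R" "\<And>x. x \<in> V \<Longrightarrow> norm x \<le> R * N x" and K: "K \<subseteq> U \<inter> V"
    for \<alpha> :: "'b \<Rightarrow> real" and V N R K
  proof -
    have "higher_deriv V N (U \<inter> V) (\<lambda>x. \<alpha> (f x)) a vs = \<alpha> (D a vs)"
      if "a \<in> K" "vs \<in> lists V" for a vs
      unfolding D_def
      by (rule higher_deriv_restrict(2)[OF U f \<alpha> N R])
        (use that K in auto)
    then show ?thesis by (simp add: growth_bound_def cong: ball_cong)
  qed
  have bf: "(\<lambda>x. \<alpha> (f x)) \<in> beurling_functions M (span B) (minkowski B) (U \<inter> span B) \<longleftrightarrow>
      (\<forall>K\<subseteq>U \<inter> span B. norm_compact (span B) (minkowski B) K \<longrightarrow>
        growth_bound M (span B) (minkowski B) K (\<lambda>a vs. \<alpha> (D a vs)))"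
    if \<alpha>: "bounded_linear \<alpha>" and B: "banach_disk B" for \<alpha> :: "'b \<Rightarrow> real" and B
  proof -
    note N = norm_on_minkowski[OF B]
    obtain R where R: "0 < R" "\<And>x. x \<in> span B \<Longrightarrow> norm x \<le> R * minkowski B x"
      using banach_disk_dominates_norm[OF B] by blast
    have smooth: "smooth_map (span B) (minkowski B) (U \<inter> span B) (\<lambda>x. \<alpha> (f x))"
      by (rule higher_deriv_restrict(1)[OF U f \<alpha> N R])
    have "growth_bound M (span B) (minkowski B) K
          (higher_deriv (span B) (minkowski B) (U \<inter> span B) (\<lambda>x. \<alpha> (f x))) \<longleftrightarrow>
        growth_bound M (span B) (minkowski B) K (\<lambda>a vs. \<alpha> (D a vs))"
      if "K \<subseteq> U \<inter> span B" for K
      by (rule cong[OF \<alpha> N R that])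
    then show ?thesis
      unfolding beurling_functions_iff[OF M N smooth] by blast
  qed
  \<comment> \<open>A set compact for the disk norm is compact in the space, so \<open>?Q\<close>
    applies to the same \<open>K\<close>.\<close>
  have disk: "growth_bound M (span B) (minkowski B) K D"
    if Q: ?Q and B: "banach_disk B" and K: "K \<subseteq> U \<inter> span B" "norm_compact (span B) (minkowski B) K"
    for B K
  proof -
    note N = norm_on_minkowski[OF B]
    obtain R where R: "0 < R" "\<And>x. x \<in> span B \<Longrightarrow> norm x \<le> R * minkowski B x"
      using banach_disk_dominates_norm[OF B] by blast
    have "growth_bound M UNIV norm K D"
      using Q K norm_compact_imp_compact[OF N R] by auto
    moreover have "bounded_multilinear_on UNIV norm k (D a)" if "a \<in> K" for a k
      using derivative_tower_higher_deriv[OF f] that K by (auto simp: derivative_tower_def D_def)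
    ultimately show ?thesis
      by (intro growth_bound_dominated[OF _ N R])
  qed
  show "beurling_class M U f \<longleftrightarrow> ?Q"
  proof
    assume L: "beurling_class M U f"
    show ?Q
    proof (intro allI impI, rule growth_bound_weak[OF M])
      fix K and \<alpha> :: "'b \<Rightarrow> real" assume "K \<subseteq> U" "compact K" "bounded_linear \<alpha>"
      \<comment> \<open>For the unit ball, \<open>span B\<close> is \<open>UNIV\<close> and
        \<open>minkowski B\<close> is \<open>norm\<close>, so \<open>bf\<close> speaks about
        \<open>U\<close> itself.\<close>
      then show "growth_bound M UNIV norm K (\<lambda>a vs. \<alpha> (D a vs))"
        using L bf[OF _ banach_disk_unit_ball, of \<alpha>] banach_disk_unit_ball[where 'a = 'a]
        unfolding beurling_class_def
        by (metis Int_UNIV_right minkowski_unit_ball norm_compact_UNIV span_unit_ball)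
    qed
  next
    assume ?Q
    then show "beurling_class M U f"
      using f bf disk by (auto simp: beurling_class_def intro: growth_bound_bounded_linear)
  qed
  have b: "beurling_class_b M U f \<longleftrightarrow> (\<forall>B K. banach_disk B \<and> K \<subseteq> U \<inter> span B \<and>
      norm_compact (span B) (minkowski B) K \<longrightarrow> growth_bound M (span B) (minkowski B) K D)"
    unfolding beurling_class_b_def growth_bound_iff_bounded[OF M] D_def using f by simp
  show "beurling_class_b M U f \<longleftrightarrow> ?Q"
  proof
    assume "beurling_class_b M U f"
    then have "K \<subseteq> U \<Longrightarrow> compact K \<Longrightarrow> growth_bound M UNIV norm K D" for K
      using b banach_disk_unit_ball[where 'a = 'a]
      by (metis Int_UNIV_right minkowski_unit_ball norm_compact_UNIV span_unit_ball)
    then show ?Q by blast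
  next
    assume ?Q
    then show "beurling_class_b M U f" unfolding b using disk by blast
  qed
qed

section \<open>Test sequences\<close>

lemma R_BeurE:
  assumes "r \<in> R_Beur"
  obtains t c where "0 < t" "\<And>k. r k * t ^ k \<le> c"
proof -
  obtain t where t: "0 < t" "(\<lambda>k. r k * t ^ k) \<longlonglongrightarrow> 0"
    using assms by (auto simp: R_Beur_def)
  then have "Bseq (\<lambda>k. r k * t ^ k)"
    by (intro convergent_imp_Bseq convergentI)
  then obtain c where "\<And>k. norm (r k * t ^ k) \<le> c"
    unfolding Bseq_def by blast
  then have "r k * t ^ k \<le> c" for k
    by (metis abs_le_D1 real_norm_def)
  with t(1) show ?thesis by (rule that)
qed

lemma power_in_R_Beur_sub:
  assumes "0 < q"
  shows "(\<lambda>k. q ^ k) \<in> R_Beur_sub"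
proof -
  \<comment> \<open>The parameter \<open>1 / q\<close> would only give the constant sequence 1; half
    of it gives a null sequence.\<close>
  have "(\<lambda>k. q ^ k * (1 / (2 * q)) ^ k) = (\<lambda>k. (1 / 2) ^ k)"
    using assms by (simp add: power_mult_distrib[symmetric])
  moreover have "(\<lambda>k. (1 / 2 :: real) ^ k) \<longlonglongrightarrow> 0"
    by (rule LIMSEQ_realpow_zero) auto
  ultimately have "(\<lambda>k. q ^ k * (1 / (2 * q)) ^ k) \<longlonglongrightarrow> 0"
    by simp
  then show ?thesis
    using assms unfolding R_Beur_sub_def R_Beur_def normalized_pos_def
    by (auto simp: power_add intro!: exI[of _ "1 / (2 * q)"])
qed

text \<open>The geometric factor is compensated by passing from \<open>t\<close> to
  \<open>t / \<delta>\<close>.\<close>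

lemma R_Beur_mult_power:
  assumes r: "r \<in> R_Beur" and \<delta>: "0 < \<delta>"
  shows "(\<lambda>k. r k * \<delta> ^ k) \<in> R_Beur"
proof -
  obtain t where t: "0 < t" "(\<lambda>k. r k * t ^ k) \<longlonglongrightarrow> 0" and "normalized_pos r"
    using r by (auto simp: R_Beur_def)
  moreover have "(\<lambda>k. r k * \<delta> ^ k * (t / \<delta>) ^ k) = (\<lambda>k. r k * t ^ k)"
    using \<delta> by (simp add: power_divide)
  ultimately show ?thesis
    using \<delta> unfolding R_Beur_def normalized_pos_def
    by (auto intro!: exI[of _ "t / \<delta>"])
qed

section \<open>Reciprocal weights as test sequences\<close>

lemma upper_circ_ge:
  assumes "0 < k" "\<alpha> \<in> compositions k"
  shows "m (length \<alpha>) * prod_list (map m \<alpha>) \<le> upper_circ m k"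
proof -
  have "finite {m (length \<alpha>) * prod_list (map m \<alpha>) |\<alpha>. \<alpha> \<in> compositions k}"
    by (simp add: finite_compositions setcompr_eq_image)
  then show ?thesis
    using assms unfolding upper_circ_def by (auto intro!: Max_ge)
qed

lemma lower_circE:
  assumes "0 < k"
  obtains \<alpha> where "\<alpha> \<in> compositions k" "lower_circ s k = s (length \<alpha>) * prod_list (map s \<alpha>)"
proof -
  let ?S = "{s (length \<alpha>) * prod_list (map s \<alpha>) |\<alpha>. \<alpha> \<in> compositions k}"
  have "finite ?S"
    by (simp add: finite_compositions setcompr_eq_image)
  moreover have "?S \<noteq> {}"
    using compositions_nonempty[OF assms] by blast
  ultimately have "Min ?S \<in> ?S" by (rule Min_in)
  then show ?thesis
    using that assms unfolding lower_circ_def by auto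
qed

text \<open>Reciprocals turn the products under the maximum into those under the minimum. A
  composition attaining the minimum competes in the maximum.\<close>

lemma inverse_upper_circ_le_lower_circ:
  assumes m: "\<And>k. 0 < m k"
  shows "1 / upper_circ m k \<le> lower_circ (\<lambda>k. 1 / m k) k"
proof (cases "k = 0")
  case False
  then have k: "0 < k" by simp
  have inv: "prod_list (map (\<lambda>k. 1 / m k) \<alpha>) = 1 / prod_list (map m \<alpha>)" for \<alpha>
    by (induction \<alpha>) auto
  have pos: "0 < prod_list (map m \<alpha>)" for \<alpha>
    by (induction \<alpha>) (auto simp: m)
  obtain \<alpha> where \<alpha>: "\<alpha> \<in> compositions k"
    "lower_circ (\<lambda>k. 1 / m k) k = 1 / m (length \<alpha>) * prod_list (map (\<lambda>k. 1 / m k) \<alpha>)"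
    by (rule lower_circE[OF k])
  then have "lower_circ (\<lambda>k. 1 / m k) k = 1 / (m (length \<alpha>) * prod_list (map m \<alpha>))"
    by (simp add: inv)
  also have "\<dots> \<ge> 1 / upper_circ m k"
    using upper_circ_ge[OF k \<alpha>(1), of m] m[of "length \<alpha>"] pos[of \<alpha>]
    by (intro divide_left_mono mult_pos_pos) (auto intro: less_le_trans[OF mult_pos_pos])
  finally show ?thesis .
qed (simp add: upper_circ_def lower_circ_def)

lemma standard_log_convex_matrixD:
  assumes "standard_log_convex_matrix M" "0 < x"
  shows "0 < M x k" "M x 0 = 1"
  using assms by (auto simp: standard_log_convex_matrix_def weight_sequence_def normalized_weight_def)

lemma inverse_weight_in_S_Beur:
  assumes M: "standard_log_convex_matrix M" and x: "0 < x"
  shows "(\<lambda>k. 1 / div_fact (M x) k) \<in> S_Beur M"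
proof -
  have "0 < div_fact (M x) k" for k
    using standard_log_convex_matrixD(1)[OF M x] by (simp add: div_fact_def)
  moreover have "div_fact (M x) 0 = 1"
    using standard_log_convex_matrixD(2)[OF M x] by (simp add: div_fact_def)
  ultimately have "normalized_pos (\<lambda>k. 1 / div_fact (M x) k)"
    and "\<forall>k. 1 / div_fact (M x) k * div_fact (M x) k \<le> 1 ^ k"
    by (auto simp: normalized_pos_def less_imp_neq[symmetric])
  then show ?thesis
    unfolding S_Beur_def using x zero_less_one[where 'a = real] by blast
qed

text \<open>The hypothesis on \<open>upper_circ\<close> enters the equivalence here: it makes the
  reciprocal of \<open>div_fact (M y)\<close> a witness for \<open>s'\<close>.\<close>

lemma inverse_weight_in_S_Beur_FdB:
  assumes M: "standard_log_convex_matrix M" and x: "0 < x" and y: "0 < y"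
    and le: "seq_preceq (upper_circ (div_fact (M y))) (div_fact (M x))"
  shows "(\<lambda>k. 1 / div_fact (M x) k) \<in> S_Beur_FdB M"
proof -
  obtain C1 C2 where C: "1 \<le> C1" "1 \<le> C2"
    and bound: "\<And>j. upper_circ (div_fact (M y)) j \<le> C2 * C1 ^ j * div_fact (M x) j"
    using le by (auto simp: seq_preceq_def)
  have pos: "0 < div_fact (M z) k" if "0 < z" for z k
    using standard_log_convex_matrixD(1)[OF M that] by (simp add: div_fact_def)
  \<comment> \<open>The family admits only a constant of the form \<open>D ^ k\<close>. As
    \<open>1 \<le> C2\<close>, the single factor \<open>C2\<close> is at most \<open>C2 ^ k\<close>
    for positive \<open>k\<close>; for \<open>k = 0\<close> both sides are 1.\<close>
  have "1 / div_fact (M x) k \<le> (C1 * C2) ^ k * lower_circ (\<lambda>k. 1 / div_fact (M y) k) k" for k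
  proof (cases "k = 0")
    case True
    then show ?thesis
      using standard_log_convex_matrixD(2)[OF M x] by (simp add: lower_circ_def div_fact_def)
  next
    case False
    then have k: "0 < k" by simp
    \<comment> \<open>The one-part composition shows that the maximum is positive, so reciprocals
      reverse the inequality.\<close>
    have "0 < div_fact (M y) (length [k]) * prod_list (map (div_fact (M y)) [k])"
      using pos[OF y] by simp
    also have "\<dots> \<le> upper_circ (div_fact (M y)) k"
      by (rule upper_circ_ge[OF k compositions_nonempty[OF k]])
    finally have u: "0 < upper_circ (div_fact (M y)) k" .
    have "C2 ^ 1 \<le> C2 ^ k" using C k by (intro power_increasing) auto
    then have "C2 * C1 ^ k * div_fact (M x) k \<le> (C1 * C2) ^ k * div_fact (M x) k"
      using C pos[OF x, of k] by (simp add: power_mult_distrib mult.commute)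
    with bound[of k] have "upper_circ (div_fact (M y)) k \<le> (C1 * C2) ^ k * div_fact (M x) k"
      by simp
    then have "1 / div_fact (M x) k \<le> (C1 * C2) ^ k * (1 / upper_circ (div_fact (M y)) k)"
      using u pos[OF x, of k] by (simp add: field_simps)
    also have "\<dots> \<le> (C1 * C2) ^ k * lower_circ (\<lambda>k. 1 / div_fact (M y) k) k"
      using C inverse_upper_circ_le_lower_circ[of "div_fact (M y)" k, OF pos[OF y]]
      by (intro mult_left_mono) auto
    finally show ?thesis .
  qed
  moreover have "0 < C1 * C2" using C by simp
  ultimately show ?thesis
    unfolding S_Beur_FdB_def
    using inverse_weight_in_S_Beur[OF M x] inverse_weight_in_S_Beur[OF M y] by blast
qed

lemma growth_bound_imp_bounded_test:
  assumes M: "\<forall>x>0. \<forall>k. 0 < M x k" and D: "growth_bound M V N K D"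
    and r: "r \<in> R_Beur" and s: "s \<in> S_Beur M"
  shows "bounded {(r k * s k / fact k) *\<^sub>R D a vs
    |k a vs. a \<in> K \<and> vs \<in> lists V \<and> length vs = k \<and> (\<forall>v\<in>set vs. N v \<le> 1)}"
proof -
  obtain t c where t: "0 < t" and c: "\<And>k. r k * t ^ k \<le> c"
    using R_BeurE[OF r] by blast
  obtain x C where x: "0 < x" and C: "0 < C" "\<And>k. s k * div_fact (M x) k \<le> C ^ k"
    and s_pos: "\<And>k. 0 < s k"
    using s by (auto simp: S_Beur_def normalized_pos_def)
  have r_pos: "0 < r k" for k
    using r by (auto simp: R_Beur_def normalized_pos_def)
  \<comment> \<open>With \<open>h = t / C\<close> the weighted derivative splits into
    \<open>r k * t ^ k\<close>, bounded by \<open>c\<close>, and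
    \<open>s k * div_fact (M x) k / C ^ k\<close>, bounded by 1.\<close>
  have "0 < t / C" using t C by simp
  with D x obtain b where b: "\<forall>a\<in>K. \<forall>vs\<in>lists V. (\<forall>v\<in>set vs. N v \<le> 1) \<longrightarrow>
      norm (D a vs) \<le> b * ((t / C) ^ length vs * M x (length vs))"
    by (rule growth_boundE)
  have "\<bar>r k * s k / fact k\<bar> * norm (D a vs) \<le> c * \<bar>b\<bar>"
    if a: "a \<in> K" "vs \<in> lists V" "\<forall>v\<in>set vs. N v \<le> 1" and k: "k = length vs" for a vs k
  proof -
    have "b * ((t / C) ^ k * M x k) \<le> \<bar>b\<bar> * ((t / C) ^ k * M x k)"
      using t C M x by (intro mult_right_mono mult_nonneg_nonneg) (auto intro: less_imp_le)
    with b[rule_format, OF a(1,2)] a(3) have "norm (D a vs) \<le> \<bar>b\<bar> * ((t / C) ^ k * M x k)"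
      unfolding k by fastforce
    then have "\<bar>r k * s k / fact k\<bar> * norm (D a vs) \<le>
        \<bar>r k * s k / fact k\<bar> * (\<bar>b\<bar> * ((t / C) ^ k * M x k))"
      by (rule mult_left_mono) simp
    also have "\<dots> = \<bar>b\<bar> * ((r k * t ^ k) * (s k * div_fact (M x) k / C ^ k))"
      using r_pos[of k] s_pos[of k] by (simp add: div_fact_def abs_mult power_divide)
    also have "\<dots> \<le> \<bar>b\<bar> * (c * 1)"
    proof (intro mult_left_mono mult_mono c)
      show "s k * div_fact (M x) k / C ^ k \<le> 1"
        using C by simp
      show "0 \<le> c"
        using c[of 0] r_pos[of 0] by simp
      show "0 \<le> s k * div_fact (M x) k / C ^ k"
        using s_pos[of k] C(1) M x by (simp add: div_fact_def less_imp_le)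
    qed auto
    finally show ?thesis by (simp add: mult.commute)
  qed
  then show ?thesis
    unfolding bounded_scaled_deriv_iff by blast
qed

section \<open>Equivalence of the classes and the two test conditions\<close>

theorem proposition4p10:
  fixes M :: "real \<Rightarrow> nat \<Rightarrow> real"
    and U :: "'a::banach set"
    and f :: "'a \<Rightarrow> 'b::banach"
  assumes "standard_log_convex_matrix M"
    and "\<forall>x>0. \<exists>y>0. seq_preceq (upper_circ (div_fact (M y))) (div_fact (M x))"
    and "open U"
    and "smooth_map UNIV norm U f"
  shows "(beurling_class M U f \<longleftrightarrow> beurling_class_b M U f) \<and>
    (beurling_class M U f \<longleftrightarrow>
      (\<forall>K r s. compact K \<and> K \<subseteq> U \<and> r \<in> R_Beur \<and> s \<in> S_Beur M \<longrightarrow>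
        bounded {(r k * s k / fact k) *\<^sub>R higher_deriv UNIV norm U f a vs
                 |k a vs. a \<in> K \<and> length vs = k \<and> (\<forall>v\<in>set vs. norm v \<le> 1)})) \<and>
    (beurling_class M U f \<longleftrightarrow>
      (\<forall>K r s. compact K \<and> K \<subseteq> U \<and> r \<in> R_Beur_sub \<and> s \<in> S_Beur_FdB M \<longrightarrow>
        (\<forall>\<delta>>0.
          bounded {(r k * s k * \<delta> ^ k / fact k) *\<^sub>R higher_deriv UNIV norm U f a vs
                   |k a vs. a \<in> K \<and> length vs = k \<and> (\<forall>v\<in>set vs. norm v \<le> 1)})))"
    (is "(?class \<longleftrightarrow> ?class_b) \<and> (?class \<longleftrightarrow> ?test) \<and> (?class \<longleftrightarrow> ?test_FdB)")
proof -
  let ?D = "higher_deriv UNIV norm U f"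
  have M: "\<forall>x>0. \<forall>k. 0 < M x k"
    using standard_log_convex_matrixD(1)[OF assms(1)] by blast
  note class_iff = beurling_class_iff[OF M assms(3,4)]
  \<comment> \<open>The test conditions are linked in a cycle: \<open>?class\<close> gives
    \<open>?test\<close>, this gives \<open>?test_FdB\<close>, and this gives
    \<open>?class\<close>.\<close>
  have class_test: ?test if ?class
  proof (intro allI impI)
    fix K r s assume *: "compact K \<and> K \<subseteq> U \<and> r \<in> R_Beur \<and> s \<in> S_Beur M"
    then have "growth_bound M UNIV norm K ?D"
      using that class_iff(1) by blast
    from growth_bound_imp_bounded_test[OF M this, of r s] *
    show "bounded {(r k * s k / fact k) *\<^sub>R ?D a vs
        |k a vs. a \<in> K \<and> length vs = k \<and> (\<forall>v\<in>set vs. norm v \<le> 1)}"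
      by (simp add: lists_UNIV)
  qed
  have test_FdB: ?test_FdB if ?test
  proof (intro allI impI)
    fix K r s and \<delta> :: real
    assume *: "compact K \<and> K \<subseteq> U \<and> r \<in> R_Beur_sub \<and> s \<in> S_Beur_FdB M" and \<delta>: "0 < \<delta>"
    \<comment> \<open>The factor \<open>\<delta> ^ k\<close> is moved into the first test
      sequence.\<close>
    then have "(\<lambda>k. r k * \<delta> ^ k) \<in> R_Beur" "s \<in> S_Beur M"
      by (auto simp: R_Beur_sub_def S_Beur_FdB_def intro: R_Beur_mult_power)
    with * that have "bounded {((r k * \<delta> ^ k) * s k / fact k) *\<^sub>R ?D a vs
        |k a vs. a \<in> K \<and> length vs = k \<and> (\<forall>v\<in>set vs. norm v \<le> 1)}"
      by blast
    then show "bounded {(r k * s k * \<delta> ^ k / fact k) *\<^sub>R ?D a vs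
        |k a vs. a \<in> K \<and> length vs = k \<and> (\<forall>v\<in>set vs. norm v \<le> 1)}"
      by (simp add: mult.assoc mult.commute mult.left_commute)
  qed
  have FdB_class: ?class if ?test_FdB
    unfolding class_iff(1)
  proof (intro allI impI)
    fix K assume K: "K \<subseteq> U" "compact K"
    show "growth_bound M UNIV norm K ?D"
      unfolding growth_bound_iff_bounded[OF M]
    proof (intro allI impI)
      fix x h :: real assume x: "0 < x" and h: "0 < h"
      obtain y where "0 < y" "seq_preceq (upper_circ (div_fact (M y))) (div_fact (M x))"
        using assms(2) x by blast
      then have s: "(\<lambda>k. 1 / div_fact (M x) k) \<in> S_Beur_FdB M"
        by (rule inverse_weight_in_S_Beur_FdB[OF assms(1) x])
      have r: "(\<lambda>k. (1 / h) ^ k) \<in> R_Beur_sub"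
        using h by (intro power_in_R_Beur_sub) simp
      \<comment> \<open>With \<open>\<delta> = 1\<close> the factorials cancel and the test sets
        become exactly the sets of growth quotients.\<close>
      have w: "(1 / h) ^ k * (1 / div_fact (M x) k) * 1 ^ k / fact k = 1 / (h ^ k * M x k)" for k
        by (simp add: div_fact_def power_divide)
      have "bounded {((1 / h) ^ k * (1 / div_fact (M x) k) * 1 ^ k / fact k) *\<^sub>R ?D a vs
          |k a vs. a \<in> K \<and> length vs = k \<and> (\<forall>v\<in>set vs. norm v \<le> 1)}"
        using that[rule_format, OF conjI, OF K(2) conjI, OF K(1) conjI, OF r s, of 1] by simp
      then show "bounded {(1 / (h ^ k * M x k)) *\<^sub>R ?D a vs
          |k a vs. a \<in> K \<and> vs \<in> lists UNIV \<and> length vs = k \<and> (\<forall>v\<in>set vs. norm v \<le> 1)}"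
        unfolding w by (simp add: lists_UNIV)
    qed
  qed
  have "?class \<longleftrightarrow> ?class_b"
    using class_iff by blast
  with class_test test_FdB FdB_class show ?thesis by argo
qed

end
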